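(* Assume that $F:C_\mu\to H$ is globally Lipschitz continuous; that $G$ maps $C_\mu$ into $L(U;D((-A)^\nu))$ for some $\nu\in(0,1)$ and is Lipschitz continuous, $\|G(x)-G(y)\|_{L(U;D((-A)^\nu))}\le L_{G,\nu}\|x-y\|_\mu$ for $x,y\in C_\mu$; and that there is a Lipschitz continuous map $K:C_\mu\to L(U;H)$ such that for every $T>0$ and every $u\in C([-\mu,T];H)$ the mapping $t\mapsto G(u_t)$ belongs to $C^1([0,T];L(U;H))$ with $\frac{d}{dt}G(u_t)=K(u_t)$. Then for every $\omega\in\Omega$ there exists $T(\omega)>0$ such that for every $\xi\in C_\mu$ there is a unique (local mild solution) $u\in C([-\mu,T(\omega)];H)$ satisfying $u(t)=\xi(t)$ for $t\in[-\mu,0]$ and $$u(t)=S(t)\xi(0)+\int_0^t S(t-r)F(u_r)\,dr+\int_0^t A S(t-r)G(u_r)\omega(r)\,dr+G(u_t)\omega(t)-\int_0^t S(t-r)K(u_r)\omega(r)\,dr$$ for $t\in[0,T(\omega)]$. Moreover, $u$ depends continuously on $\xi$ (as a map from $C_\mu$ to $C([-\mu,T(\omega)];H)$).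
   Context: $H$ and $U$ are separable Hilbert spaces with norms $|\cdot|$ and $|\cdot|_U$. Fix $\mu>0$; $C_\mu=C([-\mu,0];H)$ with sup norm $\|\cdot\|_\mu$. For $u\in C([-\mu,T];H)$ (sup norm) and $t\in[0,T]$, $u_t\in C_\mu$ is defined by $u_t(s)=u(t+s)$, $s\in[-\mu,0]$. $-A$ is a strictly positive symmetric (self-adjoint) operator on $H$ with compact inverse, and $A$ generates an analytic $C_0$-semigroup $S=(S(t))_{t\ge0}$ on $H$. $D((-A)^\gamma)$, $\gamma\ge0$, are the domains of the fractional powers with their usual norms. There is $\lambda>0$ such that for $t>0$ (constants normalized to $1$): $|S(t)|\le e^{-\lambda t}$; $|(-A)^\gamma S(t)|_{L(H)}\le t^{-\gamma}e^{-\lambda t}$ for $\gamma\in[0,1)$; $|S(t)-\mathrm{id}|_{L(D((-A)^\sigma),D((-A)^\theta))}\le t^{\sigma-\theta}$ for $\theta\ge0$, $\sigma\in[\theta,1+\theta]$. Fix $\beta\in(0,1/2)$. $\Omega$ is the set of continuous paths $\omega:\mathbb{R}\to U$ with $\omega(0)=0$ having finite $\beta$-Hölder seminorm on every interval $[-k,k]$, $k\in\mathbb{N}$. (It has full measure for the Wiener measure on $C_0(\mathbb{R};U)$ with a trace-class covariance operator $Q$.) The displayed equation is the pathwise meaning given to the mild form of the delay SPDE $du=(Au(t)+F(u_t))dt+G(u_t)dW(t)$, $u=\xi$ on $[-\mu,0]$: the stochastic integral $\int_0^tS(t-r)G(u_r)d\omega(r)$ is interpreted as $G(u_t)\omega(t)+\int_0^tAS(t-r)G(u_r)\omega(r)dr-\int_0^tS(t-r)K(u_r)\omega(r)dr$.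 *)

theory Defs
  imports "HOL-Analysis.Analysis"
begin

section \<open>Unbounded operators\<close>

text \<open>An unbounded operator is a pair of a domain D and a total function whose values
  outside D are irrelevant.\<close>

definition self_adjoint_op :: "'h::real_inner set \<Rightarrow> ('h \<Rightarrow> 'h) \<Rightarrow> bool" where
  "self_adjoint_op D B \<longleftrightarrow>
     subspace D \<and> closure D = UNIV \<and>
     (\<forall>x\<in>D. \<forall>y\<in>D. B (x + y) = B x + B y) \<and>
     (\<forall>c. \<forall>x\<in>D. B (c *\<^sub>R x) = c *\<^sub>R B x) \<and>
     (\<forall>x\<in>D. \<forall>y\<in>D. B x \<bullet> y = x \<bullet> B y) \<and>
     (\<forall>y z. (\<forall>x\<in>D. B x \<bullet> y = x \<bullet> z) \<longrightarrow> y \<in> D)"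

definition strictly_positive_op :: "'h::real_inner set \<Rightarrow> ('h \<Rightarrow> 'h) \<Rightarrow> bool" where
  "strictly_positive_op D B \<longleftrightarrow> (\<forall>x\<in>D. x \<noteq> 0 \<longrightarrow> B x \<bullet> x > 0)"

definition compact_operator :: "('a::real_normed_vector \<Rightarrow> 'b::real_normed_vector) \<Rightarrow> bool" where
  "compact_operator L \<longleftrightarrow> bounded_linear L \<and> compact (closure (L ` ball 0 1))"

definition has_compact_inverse :: "'h::real_normed_vector set \<Rightarrow> ('h \<Rightarrow> 'h) \<Rightarrow> bool" where
  "has_compact_inverse D B \<longleftrightarrow> bij_betw B D UNIV \<and> compact_operator (the_inv_into D B)"

section \<open>Fractional powers\<close>

definition eigenbasis :: "'h::real_inner set \<Rightarrow> ('h \<Rightarrow> 'h) \<Rightarrow> 'h set \<Rightarrow> bool" where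
  "eigenbasis D B E \<longleftrightarrow>
     E \<subseteq> D \<and> pairwise orthogonal E \<and> (\<forall>e\<in>E. norm e = 1) \<and>
     closure (span E) = UNIV \<and> (\<forall>e\<in>E. \<exists>c. B e = c *\<^sub>R e)"

text \<open>The spectral series for y = B^\<gamma> x; the eigenvalue of a unit eigenvector e is
  the inner product of B e and e. A self-adjoint operator with compact inverse has an eigenbasis,
  and the value of the series does not depend on which one is taken. By orthogonality the series
  converges in norm iff its squared coefficients are summable, so this also describes the
  domain.\<close>

definition has_frac_power ::
  "'h::real_inner set \<Rightarrow> ('h \<Rightarrow> 'h) \<Rightarrow> real \<Rightarrow> 'h \<Rightarrow> 'h \<Rightarrow> bool" where
  "has_frac_power D B \<gamma> x y \<longleftrightarrow>
     (\<exists>E. eigenbasis D B E \<and> ((\<lambda>e. ((B e \<bullet> e) powr \<gamma> * (x \<bullet> e)) *\<^sub>R e) has_sum y) E)"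

definition frac_dom :: "'h::real_inner set \<Rightarrow> ('h \<Rightarrow> 'h) \<Rightarrow> real \<Rightarrow> 'h set" where
  "frac_dom D B \<gamma> = {x. \<exists>y. has_frac_power D B \<gamma> x y}"

definition frac_power :: "'h::real_inner set \<Rightarrow> ('h \<Rightarrow> 'h) \<Rightarrow> real \<Rightarrow> 'h \<Rightarrow> 'h" where
  "frac_power D B \<gamma> x = (THE y. has_frac_power D B \<gamma> x y)"

definition frac_norm :: "'h::real_inner set \<Rightarrow> ('h \<Rightarrow> 'h) \<Rightarrow> real \<Rightarrow> 'h \<Rightarrow> real" where
  "frac_norm D B \<gamma> x = norm (frac_power D B \<gamma> x)"

text \<open>The space L(U; D(B^\<gamma>)), as a subset of L(U; H). As B^\<gamma> is an isometry from D(B^\<gamma>)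
  onto its range in H, the operator norm of L in this space is that of B^\<gamma> L in L(U; H).\<close>

definition frac_blinfuns ::
  "'h::real_inner set \<Rightarrow> ('h \<Rightarrow> 'h) \<Rightarrow> real \<Rightarrow> ('u::real_normed_vector \<Rightarrow>\<^sub>L 'h) set" where
  "frac_blinfuns D B \<gamma> =
     {L. (\<forall>v. blinfun_apply L v \<in> frac_dom D B \<gamma>) \<and>
         bounded_linear (\<lambda>v. frac_power D B \<gamma> (blinfun_apply L v))}"

definition frac_blinfun_norm ::
  "'h::real_inner set \<Rightarrow> ('h \<Rightarrow> 'h) \<Rightarrow> real \<Rightarrow> ('u::real_normed_vector \<Rightarrow>\<^sub>L 'h) \<Rightarrow> real" where
  "frac_blinfun_norm D B \<gamma> L = onorm (\<lambda>v. frac_power D B \<gamma> (blinfun_apply L v))"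

section \<open>Semigroups\<close>

text \<open>Only the values of S at nonnegative times matter.\<close>

definition C0_semigroup :: "(real \<Rightarrow> 'h::real_normed_vector \<Rightarrow>\<^sub>L 'h) \<Rightarrow> bool" where
  "C0_semigroup S \<longleftrightarrow>
     S 0 = id_blinfun \<and>
     (\<forall>s\<ge>0. \<forall>t\<ge>0. S (s + t) = S s o\<^sub>L S t) \<and>
     (\<forall>x. ((\<lambda>t. S t x) \<longlongrightarrow> x) (at_right 0))"

definition is_generator ::
  "'h::real_normed_vector set \<Rightarrow> ('h \<Rightarrow> 'h) \<Rightarrow> (real \<Rightarrow> 'h \<Rightarrow>\<^sub>L 'h) \<Rightarrow> bool" where
  "is_generator D A S \<longleftrightarrow>
     (\<forall>x y. (x \<in> D \<and> A x = y) \<longleftrightarrow> ((\<lambda>t. (S t x - x) /\<^sub>R t) \<longlongrightarrow> y) (at_right 0))"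

text \<open>H is a real space, so the holomorphic extension of an analytic semigroup to a sector acts on
  the complexification of H. It is modelled as H \<times> H, where (x, y) stands for x + iy.\<close>

definition cscale :: "complex \<Rightarrow> 'h::real_vector \<times> 'h \<Rightarrow> 'h \<times> 'h" where
  "cscale c p = (Re c *\<^sub>R fst p - Im c *\<^sub>R snd p, Im c *\<^sub>R fst p + Re c *\<^sub>R snd p)"

definition sector :: "real \<Rightarrow> complex set" where
  "sector \<phi> = {z. z \<noteq> 0 \<and> \<bar>Arg z\<bar> < \<phi>}"

definition analytic_semigroup :: "(real \<Rightarrow> 'h::real_inner \<Rightarrow>\<^sub>L 'h) \<Rightarrow> bool" where
  "analytic_semigroup S \<longleftrightarrow>
     (\<exists>\<phi> Z. 0 < \<phi> \<and> \<phi> \<le> pi / 2 \<and>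
        (\<forall>t\<ge>0. \<forall>x y. blinfun_apply (Z (complex_of_real t)) (x, y) = (S t x, S t y)) \<and>
        (\<forall>z\<in>sector \<phi>. \<forall>c p. blinfun_apply (Z z) (cscale c p) = cscale c (Z z p)) \<and>
        (\<forall>z\<in>sector \<phi>. \<forall>w\<in>sector \<phi>. Z (z + w) = Z z o\<^sub>L Z w) \<and>
        (\<forall>p. \<forall>z\<in>sector \<phi>. \<exists>d. ((\<lambda>w. Z w p) has_derivative (\<lambda>h. cscale h d)) (at z)) \<and>
        (\<forall>p. ((\<lambda>z. Z z p) \<longlongrightarrow> p) (at 0 within sector \<phi>)))"

section \<open>Paths\<close>

text \<open>C([a,b];H) with the supremum metric. Its elements are \<^const>\<open>extensional\<close> functions
  (undefined outside the interval), so that equality in this space is equality on the interval.\<close>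

definition path_space :: "real \<Rightarrow> real \<Rightarrow> (real \<Rightarrow> 'h::metric_space) metric" where
  "path_space a b = cfunspace (top_of_set {a..b}) euclidean_metric"

definition segment :: "real \<Rightarrow> (real \<Rightarrow> 'h) \<Rightarrow> real \<Rightarrow> (real \<Rightarrow> 'h)" where
  "segment \<mu> u t = (\<lambda>s\<in>{-\<mu>..0}. u (t + s))"

definition holder_paths :: "real \<Rightarrow> (real \<Rightarrow> 'u::real_normed_vector) set" where
  "holder_paths \<beta> = {\<omega>. continuous_on UNIV \<omega> \<and> \<omega> 0 = 0 \<and>
     (\<forall>k::nat. \<exists>C. \<forall>s\<in>{-real k..real k}. \<forall>t\<in>{-real k..real k}.
        norm (\<omega> t - \<omega> s) \<le> C * \<bar>t - s\<bar> powr \<beta>)}"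

section \<open>Mild solutions\<close>

text \<open>In the second integral the integrand is defined for r < t, since an analytic semigroup maps
  H into the domain of its generator; the single point r = t is negligible.\<close>

definition mild_solution ::
  "('h \<Rightarrow> 'h) \<Rightarrow> (real \<Rightarrow> 'h \<Rightarrow>\<^sub>L 'h) \<Rightarrow>
   ((real \<Rightarrow> 'h) \<Rightarrow> 'h) \<Rightarrow> ((real \<Rightarrow> 'h) \<Rightarrow> 'u::real_normed_vector \<Rightarrow>\<^sub>L 'h) \<Rightarrow>
   ((real \<Rightarrow> 'h) \<Rightarrow> 'u \<Rightarrow>\<^sub>L 'h) \<Rightarrow>
   real \<Rightarrow> (real \<Rightarrow> 'u) \<Rightarrow> real \<Rightarrow> (real \<Rightarrow> 'h::{real_inner,banach,second_countable_topology}) \<Rightarrow>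
   (real \<Rightarrow> 'h) \<Rightarrow> bool" where
  "mild_solution A S F G K \<mu> \<omega> T \<xi> u \<longleftrightarrow>
     u \<in> mspace (path_space (-\<mu>) T) \<and>
     (\<forall>t\<in>{-\<mu>..0}. u t = \<xi> t) \<and>
     (\<forall>t\<in>{0..T}. u t =
        S t (\<xi> 0)
        + (LINT r:{0..t}|lborel. S (t - r) (F (segment \<mu> u r)))
        + (LINT r:{0..t}|lborel. A (S (t - r) (G (segment \<mu> u r) (\<omega> r))))
        + G (segment \<mu> u t) (\<omega> t)
        - (LINT r:{0..t}|lborel. S (t - r) (K (segment \<mu> u r) (\<omega> r))))"

end

theory Submission
  imports Defs
begin

text \<open>
  A mild solution is a fixed point of the right-hand side of the equation, and for a short time this
  right-hand side is a contraction. The stochastic integral has been integrated by parts, so that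
  \<omega> itself enters the equation, as a factor of every term that contains G or K. As \<omega>
  is continuous and \<omega>(0) = 0, these factors are small on a short interval [0, T], while the
  integral of the term with F has a Lipschitz constant proportional to T. The smallness depends on
  \<omega> and on the Lipschitz constants but not on the initial segment \<xi>, so one time T serves
  all \<xi>. A contraction with constant 1/2 whose data enter with constant 1 yields existence,
  uniqueness and Lipschitz dependence on \<xi> (\<open>delay_equation_wellposed\<close>).

  The one term that needs the structure of A is the integral of A S(t - r) G(u_r) \<omega>(r),
  as A S(t) blows up like 1/t. The values of G lie in the domain of (-A) to the power \<nu>, and on
  that domain the singularity improves to t to the power \<nu> - 1, which is integrable
  (\<open>norm_A_S_le_frac_power\<close>). All such estimates are read off in the coordinates of an orthonormal
  basis of eigenvectors of -A: there S(t) multiplies the coordinate of an eigenvector with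
  eigenvalue c by exp(-c t), and A S(t) multiplies it by -c exp(-c t). A bound between coordinates,
  uniform over the basis, is a bound between norms (\<open>norm_le_of_coefficients_le\<close>). The eigenbasis
  itself comes for free, because membership in the domain of a fractional power is expressed
  through one.

  The integral terms are convolutions with the kernels S(s) and A S(s). Their continuity in t
  follows by dominated convergence after the reflection that moves t from the kernel, which is
  singular, to the density, which is continuous (\<open>continuous_on_convolution\<close>).
\<close>

section \<open>Orthonormal expansions\<close>

definition orthonormal_basis :: "'h::real_inner set \<Rightarrow> bool" where
  "orthonormal_basis E \<longleftrightarrow>
     pairwise orthogonal E \<and> (\<forall>e\<in>E. norm e = 1) \<and> closure (span E) = UNIV"

lemma eigenbasis_orthonormal_basis: "eigenbasis D B E \<Longrightarrow> orthonormal_basis E"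
  by (simp add: eigenbasis_def orthonormal_basis_def)

lemma inner_orthonormal:
  assumes "orthonormal_basis E" "e \<in> E" "e' \<in> E"
  shows "e \<bullet> e' = (if e = e' then 1 else 0)"
  using assms
  by (auto simp: orthonormal_basis_def pairwise_def orthogonal_def dot_square_norm)

text \<open>The defect from the best approximation separates from the loss of choosing the coefficients
  \<open>a\<close> instead of the Fourier coefficients. Both Bessel's inequality and the optimality of
  the Fourier coefficients are special cases.\<close>

lemma norm_diff_orthonormal_sum:
  assumes E: "orthonormal_basis E" and F: "finite F" "F \<subseteq> E"
  shows "(norm (x - (\<Sum>e\<in>F. a e *\<^sub>R e)))\<^sup>2
           = (norm x)\<^sup>2 - (\<Sum>e\<in>F. (x \<bullet> e)\<^sup>2) + (\<Sum>e\<in>F. (x \<bullet> e - a e)\<^sup>2)"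
proof -
  let ?s = "\<Sum>e\<in>F. a e *\<^sub>R e"
  have se: "?s \<bullet> e = a e" if "e \<in> F" for e
  proof -
    have "(a e' *\<^sub>R e') \<bullet> e = (if e' = e then a e else 0)" if "e' \<in> F" for e'
    proof -
      have "e' \<in> E" "e \<in> E" using that \<open>e \<in> F\<close> F by blast+
      then show ?thesis by (simp add: inner_orthonormal[OF E])
    qed
    then have "?s \<bullet> e = (\<Sum>e'\<in>F. if e' = e then a e else 0)"
      unfolding inner_sum_left by (rule sum.cong[OF refl])
    then show ?thesis using that F by simp
  qed
  have ss: "?s \<bullet> ?s = (\<Sum>e\<in>F. (a e)\<^sup>2)"
    by (subst inner_sum_right) (simp add: se power2_eq_square)
  have xs: "x \<bullet> ?s = (\<Sum>e\<in>F. a e * (x \<bullet> e))"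
    by (simp add: inner_sum_right)
  have "(norm (x - ?s))\<^sup>2 = x \<bullet> x - 2 * (x \<bullet> ?s) + ?s \<bullet> ?s"
    by (simp add: power2_norm_eq_inner algebra_simps inner_commute)
  moreover have "(\<Sum>e\<in>F. (x \<bullet> e - a e)\<^sup>2)
      = (\<Sum>e\<in>F. (x \<bullet> e)\<^sup>2) - 2 * (\<Sum>e\<in>F. a e * (x \<bullet> e)) + (\<Sum>e\<in>F. (a e)\<^sup>2)"
    unfolding sum_distrib_left sum_subtractf[symmetric] sum.distrib[symmetric]
    by (rule sum.cong[OF refl]) (simp add: power2_diff)
  ultimately show ?thesis
    unfolding ss xs power2_norm_eq_inner by linarith
qed


text \<open>Some finite combination of basis vectors is close to x by density of the span, and the Fourier
  sum over any larger finite index set is at least as close, by the optimality of its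
  coefficients.\<close>

lemma orthonormal_expansion:
  assumes E: "orthonormal_basis E"
  shows "((\<lambda>e. (x \<bullet> e) *\<^sub>R e) has_sum x) E"
  unfolding has_sum_def
proof (rule tendstoI)
  fix \<epsilon> :: real assume "\<epsilon> > 0"
  have "x \<in> closure (span E)"
    using E by (simp add: orthonormal_basis_def)
  then obtain z where z: "z \<in> span E" "dist z x < \<epsilon>"
    using \<open>\<epsilon> > 0\<close> by (meson closure_approachable)
  then obtain F0 a where F0: "finite F0" "F0 \<subseteq> E" and za: "z = (\<Sum>e\<in>F0. a e *\<^sub>R e)"
    unfolding span_explicit by auto
  have "dist (\<Sum>e\<in>F. (x \<bullet> e) *\<^sub>R e) x < \<epsilon>" if F: "finite F" "F0 \<subseteq> F" "F \<subseteq> E" for F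
  proof -
    define b where "b e = (if e \<in> F0 then a e else 0)" for e
    have zb: "z = (\<Sum>e\<in>F. b e *\<^sub>R e)"
      unfolding za b_def using F by (intro sum.mono_neutral_cong_left) auto
    have "(norm (x - (\<Sum>e\<in>F. (x \<bullet> e) *\<^sub>R e)))\<^sup>2 \<le> (norm (x - z))\<^sup>2"
      unfolding zb norm_diff_orthonormal_sum[OF E F(1,3)] by (simp add: sum_nonneg)
    then have "norm (x - (\<Sum>e\<in>F. (x \<bullet> e) *\<^sub>R e)) \<le> norm (x - z)"
      by (rule power2_le_imp_le) simp
    with z show ?thesis by (simp add: dist_norm norm_minus_commute)
  qed
  then show "\<forall>\<^sub>F F in finite_subsets_at_top E. dist (\<Sum>e\<in>F. (x \<bullet> e) *\<^sub>R e) x < \<epsilon>"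
    unfolding eventually_finite_subsets_at_top using F0 by blast
qed

text \<open>This transfers estimates for single coordinates to the norm. By Bessel's inequality every
  finite Fourier sum of y is bounded by \<open>M * norm z\<close>, and the sums converge to y.\<close>

lemma norm_le_of_coefficients_le:
  assumes E: "orthonormal_basis E" and M: "0 \<le> M"
    and le: "\<And>e. e \<in> E \<Longrightarrow> \<bar>y \<bullet> e\<bar> \<le> M * \<bar>z \<bullet> e\<bar>"
  shows "norm y \<le> M * norm z"
proof -
  have partial: "norm (\<Sum>e\<in>F. (y \<bullet> e) *\<^sub>R e) \<le> M * norm z" if F: "finite F" "F \<subseteq> E" for F
  proof -
    have "(norm (\<Sum>e\<in>F. (y \<bullet> e) *\<^sub>R e))\<^sup>2 = (\<Sum>e\<in>F. (y \<bullet> e)\<^sup>2)"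
      using norm_diff_orthonormal_sum[OF E F, of 0 "\<lambda>e. y \<bullet> e"] by simp
    also have "\<dots> \<le> (\<Sum>e\<in>F. M\<^sup>2 * (z \<bullet> e)\<^sup>2)"
    proof (rule sum_mono)
      fix e assume "e \<in> F"
      then have "\<bar>y \<bullet> e\<bar>\<^sup>2 \<le> (M * \<bar>z \<bullet> e\<bar>)\<^sup>2"
        using le F by (intro power_mono) auto
      then show "(y \<bullet> e)\<^sup>2 \<le> M\<^sup>2 * (z \<bullet> e)\<^sup>2" by (simp add: power_mult_distrib)
    qed
    also have "\<dots> \<le> M\<^sup>2 * (norm z)\<^sup>2"
    proof -
      have "0 \<le> (norm (z - (\<Sum>e\<in>F. (z \<bullet> e) *\<^sub>R e)))\<^sup>2" by simp
      then have "(\<Sum>e\<in>F. (z \<bullet> e)\<^sup>2) \<le> (norm z)\<^sup>2"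
        unfolding norm_diff_orthonormal_sum[OF E F] by simp
      then show ?thesis
        unfolding sum_distrib_left[symmetric] by (rule mult_left_mono) simp
    qed
    finally show ?thesis
      unfolding power_mult_distrib[symmetric]
      by (rule power2_le_imp_le) (simp add: M)
  qed
  have "((\<lambda>F. norm (\<Sum>e\<in>F. (y \<bullet> e) *\<^sub>R e)) \<longlongrightarrow> norm y) (finite_subsets_at_top E)"
    using orthonormal_expansion[OF E, of y] unfolding has_sum_def by (rule tendsto_norm)
  moreover have "\<forall>\<^sub>F F in finite_subsets_at_top E. norm (\<Sum>e\<in>F. (y \<bullet> e) *\<^sub>R e) \<le> M * norm z"
    by (rule eventually_finite_subsets_at_top_weakI) (rule partial)
  ultimately show ?thesis
    by (rule tendsto_upperbound) (rule finite_subsets_at_top_neq_bot)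
qed

lemma eq_of_coefficients_eq:
  assumes E: "orthonormal_basis E" and "\<And>e. e \<in> E \<Longrightarrow> y \<bullet> e = z \<bullet> e"
  shows "y = z"
proof -
  have "norm (y - z) \<le> 0 * norm (y - z)"
    by (rule norm_le_of_coefficients_le[OF E]) (simp_all add: inner_diff_left assms(2))
  then show ?thesis by simp
qed

lemma bounded_linear_eq_0_of_basis:
  assumes E: "orthonormal_basis E" and f: "bounded_linear f" and 0: "\<And>e. e \<in> E \<Longrightarrow> f e = 0"
  shows "f x = 0"
proof -
  have "((\<lambda>e. f ((x \<bullet> e) *\<^sub>R e)) has_sum f x) E"
    by (rule has_sum_bounded_linear[OF f orthonormal_expansion[OF E]])
  moreover have "((\<lambda>e. f ((x \<bullet> e) *\<^sub>R e)) has_sum 0) E"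
    by (rule has_sum_0) (simp add: linear_scale[OF bounded_linear.linear[OF f]] 0)
  ultimately show ?thesis by (rule has_sum_unique)
qed

section \<open>Fractional powers in the coordinates of an eigenbasis\<close>

lemma eigenvector_eigenvalue:
  assumes "eigenbasis D B E" "e \<in> E"
  shows "B e = (B e \<bullet> e) *\<^sub>R e"
proof -
  obtain c where c: "B e = c *\<^sub>R e"
    using assms unfolding eigenbasis_def by blast
  have "norm e = 1"
    using assms unfolding eigenbasis_def by blast
  then have "B e \<bullet> e = c"
    unfolding c by (simp add: dot_square_norm)
  with c show ?thesis by simp
qed

text \<open>The series for the power may be taken over a basis E other than the basis E' of the
  vector e'. Symmetry of B makes e' orthogonal to every e in E with a different eigenvalue,
  so on the terms that survive the inner product with e' the factor is the power of the eigenvalue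
  of e', and it can be pulled out of the expansion of x.\<close>

lemma has_frac_power_coefficient:
  assumes sa: "self_adjoint_op D B" and E': "eigenbasis D B E'"
    and xy: "has_frac_power D B \<gamma> x y" and e': "e' \<in> E'"
  shows "y \<bullet> e' = (B e' \<bullet> e') powr \<gamma> * (x \<bullet> e')"
proof -
  from xy obtain E where E: "eigenbasis D B E"
    and sum: "((\<lambda>e. ((B e \<bullet> e) powr \<gamma> * (x \<bullet> e)) *\<^sub>R e) has_sum y) E"
    unfolding has_frac_power_def by blast
  have coef: "(B e \<bullet> e) powr \<gamma> * (x \<bullet> e) * (e \<bullet> e')
      = (B e' \<bullet> e') powr \<gamma> * ((x \<bullet> e) * (e \<bullet> e'))" if "e \<in> E" for e
  proof (cases "e \<bullet> e' = 0")
    case False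
    have "B e \<bullet> e' = e \<bullet> B e'"
      using sa E E' that e' unfolding self_adjoint_op_def eigenbasis_def by blast
    then have "(B e \<bullet> e) * (e \<bullet> e') = (B e' \<bullet> e') * (e \<bullet> e')"
      by (metis eigenvector_eigenvalue[OF E that] eigenvector_eigenvalue[OF E' e']
          inner_scaleR_left inner_scaleR_right)
    with False show ?thesis by simp
  qed simp
  have "((\<lambda>e. ((B e \<bullet> e) powr \<gamma> * (x \<bullet> e)) *\<^sub>R e \<bullet> e') has_sum (y \<bullet> e')) E"
    by (rule has_sum_bounded_linear[OF bounded_linear_inner_left sum])
  then have "((\<lambda>e. (B e' \<bullet> e') powr \<gamma> * ((x \<bullet> e) * (e \<bullet> e'))) has_sum (y \<bullet> e')) E"
    by (rule has_sum_cong[THEN iffD1, rotated]) (use coef in \<open>simp add: mult.assoc\<close>)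
  moreover have "((\<lambda>e. (x \<bullet> e) *\<^sub>R e \<bullet> e') has_sum (x \<bullet> e')) E"
    using orthonormal_expansion[OF eigenbasis_orthonormal_basis[OF E]]
    by (rule has_sum_bounded_linear[OF bounded_linear_inner_left])
  then have "((\<lambda>e. (B e' \<bullet> e') powr \<gamma> * ((x \<bullet> e) * (e \<bullet> e')))
      has_sum ((B e' \<bullet> e') powr \<gamma> * (x \<bullet> e'))) E"
    by (intro has_sum_cmult_right) simp
  ultimately show ?thesis by (rule has_sum_unique)
qed

text \<open>Hence fractional powers are diagonal in every eigenbasis, and one basis can be fixed for all
  vectors. Single-valuedness and linearity of the powers follow coordinatewise.\<close>

lemma has_frac_power_iff:
  assumes sa: "self_adjoint_op D B" and E: "eigenbasis D B E"
  shows "has_frac_power D B \<gamma> x y \<longleftrightarrow> (\<forall>e\<in>E. y \<bullet> e = (B e \<bullet> e) powr \<gamma> * (x \<bullet> e))"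
proof
  assume "\<forall>e\<in>E. y \<bullet> e = (B e \<bullet> e) powr \<gamma> * (x \<bullet> e)"
  then have "((\<lambda>e. ((B e \<bullet> e) powr \<gamma> * (x \<bullet> e)) *\<^sub>R e) has_sum y) E"
    by (intro has_sum_cong[THEN iffD1, OF _ orthonormal_expansion[OF eigenbasis_orthonormal_basis[OF E]]])
      simp
  with E show "has_frac_power D B \<gamma> x y"
    unfolding has_frac_power_def by blast
qed (use has_frac_power_coefficient[OF sa E] in blast)

lemma has_frac_power_frac_power:
  assumes sa: "self_adjoint_op D B" and E: "eigenbasis D B E" and x: "x \<in> frac_dom D B \<gamma>"
  shows "has_frac_power D B \<gamma> x (frac_power D B \<gamma> x)"
  unfolding frac_power_def
proof (rule theI')
  show "\<exists>!y. has_frac_power D B \<gamma> x y"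
    using x eq_of_coefficients_eq[OF eigenbasis_orthonormal_basis[OF E]]
    unfolding frac_dom_def has_frac_power_iff[OF sa E] by force
qed

lemma inner_frac_power:
  assumes "self_adjoint_op D B" "eigenbasis D B E" "x \<in> frac_dom D B \<gamma>" "e \<in> E"
  shows "frac_power D B \<gamma> x \<bullet> e = (B e \<bullet> e) powr \<gamma> * (x \<bullet> e)"
  using has_frac_power_frac_power[OF assms(1-3)] has_frac_power_iff[OF assms(1,2)] assms(4)
  by blast

lemma frac_power_diff:
  assumes sa: "self_adjoint_op D B" and E: "eigenbasis D B E"
    and x: "x \<in> frac_dom D B \<gamma>" and y: "y \<in> frac_dom D B \<gamma>"
  shows "x - y \<in> frac_dom D B \<gamma>"
    and "frac_power D B \<gamma> (x - y) = frac_power D B \<gamma> x - frac_power D B \<gamma> y"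
proof -
  have *: "has_frac_power D B \<gamma> (x - y) (frac_power D B \<gamma> x - frac_power D B \<gamma> y)"
    unfolding has_frac_power_iff[OF sa E]
    by (simp add: inner_diff_left inner_frac_power[OF sa E] x y algebra_simps)
  then show dom: "x - y \<in> frac_dom D B \<gamma>" unfolding frac_dom_def by blast
  show "frac_power D B \<gamma> (x - y) = frac_power D B \<gamma> x - frac_power D B \<gamma> y"
    by (rule eq_of_coefficients_eq[OF eigenbasis_orthonormal_basis[OF E]])
      (use * inner_frac_power[OF sa E dom] in \<open>simp add: has_frac_power_iff[OF sa E]\<close>)
qed

lemma frac_blinfun_diff:
  assumes sa: "self_adjoint_op D B" and E: "eigenbasis D B E"
    and L: "L \<in> frac_blinfuns D B \<gamma>" and M: "M \<in> frac_blinfuns D B \<gamma>"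
  shows "L - M \<in> frac_blinfuns D B \<gamma>"
  using L M frac_power_diff[OF sa E] unfolding frac_blinfuns_def
  by (auto simp: blinfun.diff_left intro: bounded_linear_sub)

lemma frac_blinfun_norm:
  assumes "L \<in> frac_blinfuns D B \<gamma>"
  shows "norm (frac_power D B \<gamma> (blinfun_apply L v)) \<le> frac_blinfun_norm D B \<gamma> L * norm v"
  using assms onorm unfolding frac_blinfuns_def frac_blinfun_norm_def by blast

lemma frac_blinfun_norm_nonneg:
  assumes "L \<in> frac_blinfuns D B \<gamma>"
  shows "0 \<le> frac_blinfun_norm D B \<gamma> L"
  using assms onorm_pos_le unfolding frac_blinfuns_def frac_blinfun_norm_def by blast

section \<open>The semigroup in the coordinates of an eigenbasis\<close>

lemma has_vector_derivative_right_quotient: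
  assumes "(f has_vector_derivative v) (at t)"
  shows "((\<lambda>h. (f (t + h) - f t) /\<^sub>R h) \<longlongrightarrow> v) (at_right (0::real))"
proof -
  have "((\<lambda>h. norm (f (t + h) - f t - h *\<^sub>R v) / norm h) \<longlongrightarrow> 0) (at 0)"
    using assms unfolding has_vector_derivative_def has_derivative_at by blast
  then have lim: "((\<lambda>h. norm (f (t + h) - f t - h *\<^sub>R v) / norm h) \<longlongrightarrow> 0) (at_right 0)"
    by (rule tendsto_mono[OF at_le, rotated]) simp
  have "norm (f (t + h) - f t - h *\<^sub>R v) / norm h = norm ((f (t + h) - f t) /\<^sub>R h - v)"
    if "h > 0" for h :: real
  proof -
    have "(f (t + h) - f t) /\<^sub>R h - v = (f (t + h) - f t - h *\<^sub>R v) /\<^sub>R h"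
      using that by (simp add: scaleR_diff_right)
    then show ?thesis by (simp add: divide_inverse mult.commute)
  qed
  then have "\<forall>\<^sub>F h in at_right 0. norm (f (t + h) - f t - h *\<^sub>R v) / norm h
      = norm ((f (t + h) - f t) /\<^sub>R h - v)"
    by (auto simp: eventually_at_filter)
  then have "((\<lambda>h. norm ((f (t + h) - f t) /\<^sub>R h - v)) \<longlongrightarrow> 0) (at_right 0)"
    using lim by (rule tendsto_cong[THEN iffD1])
  then show ?thesis
    by (rule LIM_zero_cancel[OF tendsto_norm_zero_cancel])
qed

text \<open>The holomorphic extension, restricted to the positive axis and to the real part of the
  complexification, gives a two-sided derivative, where the definition of the generator speaks of
  right limits only.\<close>

lemma analytic_semigroup_differentiable:
  fixes S :: "real \<Rightarrow> 'h::real_inner \<Rightarrow>\<^sub>L 'h"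
  assumes "analytic_semigroup S" "t > 0"
  obtains d where "((\<lambda>s. S s x) has_vector_derivative d) (at t)"
proof -
  from assms(1) obtain \<phi> Z where "0 < \<phi>"
    and Z: "\<And>t x y. t \<ge> 0 \<Longrightarrow> blinfun_apply (Z (complex_of_real t)) (x, y) = (S t x, S t y)"
    and dZ: "\<And>p z. z \<in> sector \<phi> \<Longrightarrow> \<exists>d. ((\<lambda>w. blinfun_apply (Z w) p) has_derivative (\<lambda>h. cscale h d)) (at z)"
    unfolding analytic_semigroup_def by metis
  have "complex_of_real t \<in> sector \<phi>"
    using assms(2) \<open>0 < \<phi>\<close> by (simp add: sector_def)
  then obtain d where d: "((\<lambda>w. blinfun_apply (Z w) (x, 0)) has_derivative (\<lambda>h. cscale h d)) (at (complex_of_real t))"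
    using dZ by blast
  have "((\<lambda>s. blinfun_apply (Z (complex_of_real s)) (x, 0)) has_derivative
      (\<lambda>h. cscale (complex_of_real h) d)) (at t)"
    using bounded_linear_imp_has_derivative[OF bounded_linear_of_real] d
    by (rule has_derivative_compose[where f = complex_of_real])
  then have "((\<lambda>s. fst (blinfun_apply (Z (complex_of_real s)) (x, 0))) has_derivative
      (\<lambda>h. fst (cscale (complex_of_real h) d))) (at t)"
    by (rule has_derivative_fst)
  then have "((\<lambda>s. fst (blinfun_apply (Z (complex_of_real s)) (x, 0))) has_vector_derivative fst d) (at t)"
    by (simp add: has_vector_derivative_def cscale_def)
  then have "((\<lambda>s. S s x) has_vector_derivative fst d) (at t)"
    by (rule has_vector_derivative_transform_within_open[where S = "{0<..}"])
      (use assms(2) Z in auto)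
  then show ?thesis by (rule that)
qed

text \<open>Joint continuity away from 0 is what makes the integrand of a convolution measurable and
  lets limits pass through it. The time s = 0 is excluded because A S(0) = A is unbounded.\<close>

definition convolution_kernel :: "(real \<Rightarrow> 'h::real_normed_vector \<Rightarrow> 'h) \<Rightarrow> bool" where
  "convolution_kernel \<Phi> \<longleftrightarrow> (\<forall>s>0. linear (\<Phi> s)) \<and> continuous_on ({0<..} \<times> UNIV) (\<lambda>(s, x). \<Phi> s x)"

text \<open>Separate continuity suffices in the presence of a locally uniform bound on the operator norms, as
  \<Phi> s x = \<Phi> s (x - x0) + \<Phi> s x0.\<close>

lemma convolution_kernelI:
  assumes lin: "\<And>s. s > 0 \<Longrightarrow> linear (\<Phi> s)"
    and cont: "\<And>x. continuous_on {0<..} (\<lambda>s. \<Phi> s x)"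
    and bound: "\<And>s x. s > 0 \<Longrightarrow> norm (\<Phi> s x) \<le> b s * norm x"
    and b: "continuous_on {0<..} b"
  shows "convolution_kernel \<Phi>"
  unfolding convolution_kernel_def
proof (intro conjI allI impI lin)
  show "continuous_on ({0<..} \<times> UNIV) (\<lambda>(s, x). \<Phi> s x)"
    unfolding continuous_on_def
  proof (rule ballI)
    fix p :: "real \<times> 'a"
    assume "p \<in> {0<..} \<times> UNIV"
    then obtain s0 x0 where p: "p = (s0, x0)" and "s0 > 0" by (cases p) auto
    let ?at = "at (s0, x0) within {0<..} \<times> UNIV"
    have fst0: "(fst \<longlongrightarrow> s0) ?at" and snd0: "(snd \<longlongrightarrow> x0) ?at"
      by (auto intro!: tendsto_eq_intros)
    have inside: "\<forall>\<^sub>F p in ?at. fst p \<in> {0<..}"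
      by (auto simp: eventually_at_filter intro!: always_eventually)
    have lim1: "((\<lambda>p. \<Phi> (fst p) x0) \<longlongrightarrow> \<Phi> s0 x0) ?at"
      by (rule continuous_on_tendsto_compose[OF cont fst0 _ inside]) (use \<open>s0 > 0\<close> in simp)
    have "((\<lambda>p. b (fst p) * norm (snd p - x0)) \<longlongrightarrow> b s0 * norm (x0 - x0)) ?at"
      by (intro tendsto_intros snd0 continuous_on_tendsto_compose[OF b fst0 _ inside])
        (use \<open>s0 > 0\<close> in simp)
    then have "((\<lambda>p. b (fst p) * norm (snd p - x0)) \<longlongrightarrow> 0) ?at" by simp
    then have lim2: "((\<lambda>p. \<Phi> (fst p) (snd p - x0)) \<longlongrightarrow> 0) ?at"
      by (rule Lim_null_comparison[rotated])
        (use inside bound in \<open>auto elim: eventually_mono\<close>)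
    have "\<forall>\<^sub>F p in ?at. \<Phi> (fst p) (snd p - x0) + \<Phi> (fst p) x0 = (case p of (s, x) \<Rightarrow> \<Phi> s x)"
      using inside by eventually_elim (auto simp: linear_diff lin)
    moreover have "((\<lambda>p. \<Phi> (fst p) (snd p - x0) + \<Phi> (fst p) x0) \<longlongrightarrow> 0 + \<Phi> s0 x0) ?at"
      by (intro tendsto_add lim1 lim2)
    ultimately show "((\<lambda>(s, x). \<Phi> s x) \<longlongrightarrow> (case p of (s, x) \<Rightarrow> \<Phi> s x))
        (at p within {0<..} \<times> UNIV)"
      unfolding p by (simp add: tendsto_cong)
  qed
qed

text \<open>A semigroup together with an eigenbasis of its generator. The decay rate will be a lower bound
  for the eigenvalues of -A.\<close>

locale diagonal_semigroup =
  fixes A :: "'h::real_inner \<Rightarrow> 'h" and D E :: "'h set"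
    and S :: "real \<Rightarrow> 'h \<Rightarrow>\<^sub>L 'h" and lam :: real
  assumes self_adjoint: "self_adjoint_op D (\<lambda>x. - A x)"
    and eigenbasis: "eigenbasis D (\<lambda>x. - A x) E"
    and semigroup: "C0_semigroup S" "analytic_semigroup S" "is_generator D A S"
    and lam_pos: "lam > 0"
    and decay: "\<And>t. t > 0 \<Longrightarrow> norm (S t) \<le> exp (- lam * t)"
begin

abbreviation eigenvalue :: "'h \<Rightarrow> real" where
  "eigenvalue e \<equiv> - A e \<bullet> e"

lemma basis: "orthonormal_basis E"
  by (rule eigenbasis_orthonormal_basis[OF eigenbasis])

lemma S_add: "s \<ge> 0 \<Longrightarrow> t \<ge> 0 \<Longrightarrow> S (s + t) x = S s (S t x)"
  using semigroup(1) unfolding C0_semigroup_def by simp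

text \<open>The derivative from analyticity is in particular the limit of the right difference quotients,
  which by the semigroup law are the quotients that define the generator at S(t) x.\<close>

lemma S_derivative:
  assumes "t > 0"
  shows "S t x \<in> D" and "((\<lambda>s. S s x) has_vector_derivative A (S t x)) (at t)"
proof -
  obtain d where d: "((\<lambda>s. S s x) has_vector_derivative d) (at t)"
    using analytic_semigroup_differentiable[OF semigroup(2) assms] .
  have "((\<lambda>h. (S (t + h) x - S t x) /\<^sub>R h) \<longlongrightarrow> d) (at_right 0)"
    by (rule has_vector_derivative_right_quotient[OF d])
  moreover have "\<forall>\<^sub>F h in at_right 0. (S (t + h) x - S t x) /\<^sub>R h = (S h (S t x) - S t x) /\<^sub>R h"
    using assms S_add[of _ t x] by (auto simp: eventually_at_filter add.commute)
  ultimately have "((\<lambda>h. (S h (S t x) - S t x) /\<^sub>R h) \<longlongrightarrow> d) (at_right 0)"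
    by (simp add: tendsto_cong)
  then have "S t x \<in> D \<and> A (S t x) = d"
    using semigroup(3) unfolding is_generator_def by blast
  with d show "S t x \<in> D" "((\<lambda>s. S s x) has_vector_derivative A (S t x)) (at t)"
    by auto
qed

lemma A_S_commute:
  assumes "t > 0" "x \<in> D"
  shows "A (S t x) = S t (A x)"
proof -
  have "((\<lambda>h. (S h x - x) /\<^sub>R h) \<longlongrightarrow> A x) (at_right 0)"
    using assms semigroup(3) unfolding is_generator_def by blast
  then have "((\<lambda>h. S t ((S h x - x) /\<^sub>R h)) \<longlongrightarrow> S t (A x)) (at_right 0)"
    by (intro tendsto_intros)
  moreover have "\<forall>\<^sub>F h in at_right 0. S t ((S h x - x) /\<^sub>R h) = (S h (S t x) - S t x) /\<^sub>R h"
  proof -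
    have "S t (S h x) = S h (S t x)" if "h > 0" for h
      using assms that S_add[of t h x] S_add[of h t x] by (simp add: add.commute)
    then show ?thesis
      by (auto simp: eventually_at_filter blinfun.diff_right blinfun.scaleR_right)
  qed
  ultimately have "((\<lambda>h. (S h (S t x) - S t x) /\<^sub>R h) \<longlongrightarrow> S t (A x)) (at_right 0)"
    by (simp add: tendsto_cong)
  then show ?thesis
    using semigroup(3) unfolding is_generator_def by blast
qed

lemma A_eigenvector:
  assumes "e \<in> E"
  shows "A e = - eigenvalue e *\<^sub>R e"
proof -
  have "- A e = eigenvalue e *\<^sub>R e"
    using eigenvector_eigenvalue[OF eigenbasis assms] .
  then show ?thesis
    by (metis minus_equation_iff scaleR_minus_left)
qed

text \<open>On an eigenvector e with eigenvalue c the function exp(c t) S(t) e has derivative 0 for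
  t > 0, and it tends to e as t tends to 0.\<close>

lemma S_eigenvector:
  assumes e: "e \<in> E" and t: "t \<ge> 0"
  shows "S t e = exp (- eigenvalue e * t) *\<^sub>R e"
proof (cases "t = 0")
  case True
  then show ?thesis using semigroup(1) by (simp add: C0_semigroup_def)
next
  case False
  define c where "c = eigenvalue e"
  define g where "g s = exp (c * s) *\<^sub>R S s e" for s
  have eD: "e \<in> D" using eigenbasis e unfolding eigenbasis_def by blast
  have "(g has_derivative (\<lambda>h. 0)) (at s within {0<..})" if "s \<in> {0<..}" for s
  proof -
    have "A (S s e) = S s (- c *\<^sub>R e)"
      using A_S_commute[OF _ eD, of s] that A_eigenvector[OF e] by (simp add: c_def)
    then have "A (S s e) = - c *\<^sub>R S s e"
      by (simp only: blinfun.scaleR_right)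
    then have "((\<lambda>s. S s e) has_vector_derivative - c *\<^sub>R S s e) (at s)"
      using S_derivative(2)[of s e] that by simp
    then have "(g has_vector_derivative
        exp (c * s) *\<^sub>R (- c *\<^sub>R S s e) + (exp (c * s) * c) *\<^sub>R S s e) (at s)"
      unfolding g_def by (intro has_vector_derivative_scaleR) (auto intro!: derivative_eq_intros)
    then have "(g has_vector_derivative 0) (at s)" by simp
    then show ?thesis
      by (simp add: has_vector_derivative_def has_derivative_at_withinI)
  qed
  then obtain k where k: "\<And>s. s \<in> {0<..} \<Longrightarrow> g s = k"
    using has_derivative_zero_constant[OF convex_real_interval(3)] by blast
  have "((\<lambda>s. S s e) \<longlongrightarrow> e) (at_right 0)"
    using semigroup(1) unfolding C0_semigroup_def by blast
  then have "(g \<longlongrightarrow> exp (c * 0) *\<^sub>R e) (at_right 0)"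
    unfolding g_def by (intro tendsto_intros) auto
  moreover have "(g \<longlongrightarrow> k) (at_right 0)"
    by (rule tendsto_eventually) (use k in \<open>auto simp: eventually_at_filter\<close>)
  ultimately have "k = e"
    using tendsto_unique[of "at_right (0::real)"] by fastforce
  then have "exp (c * t) *\<^sub>R S t e = e"
    using k[of t] t False by (simp add: g_def)
  then have "(exp (- (c * t)) * exp (c * t)) *\<^sub>R S t e = exp (- (c * t)) *\<^sub>R e"
    unfolding scaleR_scaleR[symmetric] by (rule arg_cong)
  moreover have "exp (- (c * t)) * exp (c * t) = 1"
    using exp_minus_inverse[of "c * t"] by (simp only: mult.commute)
  ultimately show ?thesis by (simp add: c_def)
qed

text \<open>The operator norm of S(1) is at least exp(-c) for every eigenvalue c of -A.\<close>

lemma eigenvalue_ge: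
  assumes e: "e \<in> E"
  shows "lam \<le> eigenvalue e"
proof -
  have "norm e = 1" using eigenbasis e unfolding eigenbasis_def by blast
  then have "exp (- eigenvalue e) = norm (S 1 e)"
    using S_eigenvector[OF e, of 1] by simp
  also have "\<dots> \<le> norm (S 1)"
    using norm_blinfun[of "S 1" e] \<open>norm e = 1\<close> by simp
  also have "\<dots> \<le> exp (- lam)" using decay[of 1] by simp
  finally show ?thesis by simp
qed

text \<open>Both sides are continuous and linear in x, so it suffices to compare them on the basis.\<close>

lemma inner_S:
  assumes e: "e \<in> E" and t: "t \<ge> 0"
  shows "S t x \<bullet> e = exp (- eigenvalue e * t) * (x \<bullet> e)"
proof -
  have "S t x \<bullet> e - exp (- eigenvalue e * t) * (x \<bullet> e) = 0"
  proof (rule bounded_linear_eq_0_of_basis[OF basis,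
        where f = "\<lambda>x. S t x \<bullet> e - exp (- eigenvalue e * t) * (x \<bullet> e)"])
    show "bounded_linear (\<lambda>x. S t x \<bullet> e - exp (- eigenvalue e * t) * (x \<bullet> e))"
      by (intro bounded_linear_intros)
    show "S t e' \<bullet> e - exp (- eigenvalue e * t) * (e' \<bullet> e) = 0" if "e' \<in> E" for e'
      using S_eigenvector[OF that t] inner_orthonormal[OF basis that e] by (cases "e' = e") simp_all
  qed
  then show ?thesis by simp
qed

lemma inner_A_S:
  assumes e: "e \<in> E" and t: "t > 0"
  shows "A (S t x) \<bullet> e = - (eigenvalue e * exp (- eigenvalue e * t)) * (x \<bullet> e)"
proof -
  have "e \<in> D" using eigenbasis e unfolding eigenbasis_def by blast
  then have "- A (S t x) \<bullet> e = S t x \<bullet> - A e"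
    using self_adjoint S_derivative(1)[OF t] unfolding self_adjoint_op_def by blast
  then have "A (S t x) \<bullet> e = S t x \<bullet> A e" by simp
  also have "\<dots> = - eigenvalue e * (S t x \<bullet> e)"
    by (subst A_eigenvector[OF e]) simp
  finally show ?thesis
    using inner_S[OF e, of t x] t by simp
qed

lemma linear_A_S:
  assumes t: "t > 0"
  shows "linear (\<lambda>x. A (S t x))"
  by (rule linearI; rule eq_of_coefficients_eq[OF basis])
    (simp_all add: inner_A_S[OF _ t] inner_add_left distrib_left mult.left_commute)

text \<open>The smoothing estimate. In the coordinate of an eigenvalue c it says
  c exp(-c t) \<le> t powr (\<nu> - 1) * c powr \<nu>, which is (c t) powr (1 - \<nu>) \<le> exp(c t). The
  vector y stands for the \<nu>-th power of -A applied to x. It is described by its coordinates,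
  so that the case \<nu> = 0, y = x, the bound 1/t on all of H, is included.\<close>

lemma norm_A_S_le:
  assumes t: "t > 0" and \<nu>: "0 \<le> \<nu>" "\<nu> \<le> 1"
    and coef: "\<And>e. e \<in> E \<Longrightarrow> y \<bullet> e = eigenvalue e powr \<nu> * (x \<bullet> e)"
  shows "norm (A (S t x)) \<le> t powr (\<nu> - 1) * norm y"
proof (rule norm_le_of_coefficients_le[OF basis])
  fix e assume e: "e \<in> E"
  define c where "c = eigenvalue e"
  have c: "c > 0" using eigenvalue_ge[OF e] lam_pos by (simp add: c_def)
  have "(c * t) powr (1 - \<nu>) \<le> exp (c * t)"
  proof (cases "c * t \<le> 1")
    case True
    then have "(c * t) powr (1 - \<nu>) \<le> 1"
      using \<nu> c t by (intro powr_le1) auto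
    also have "1 \<le> exp (c * t)" using c t by simp
    finally show ?thesis .
  next
    case False
    then have "(c * t) powr (1 - \<nu>) \<le> (c * t) powr 1"
      using \<nu> by (intro powr_mono) auto
    also have "\<dots> = c * t" using c t by simp
    also have "\<dots> \<le> exp (c * t)"
      using exp_ge_add_one_self[of "c * t"] by linarith
    finally show ?thesis .
  qed
  then have "(c * t) powr (1 - \<nu>) * exp (- (c * t)) \<le> 1"
    by (simp add: exp_minus field_simps)
  then have "t powr (\<nu> - 1) * c powr \<nu> * ((c * t) powr (1 - \<nu>) * exp (- (c * t)))
      \<le> t powr (\<nu> - 1) * c powr \<nu> * 1"
    by (rule mult_left_mono) simp
  also have "t powr (\<nu> - 1) * c powr \<nu> * ((c * t) powr (1 - \<nu>) * exp (- (c * t)))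
      = (t powr (\<nu> - 1) * t powr (1 - \<nu>)) * (c powr \<nu> * c powr (1 - \<nu>)) * exp (- (c * t))"
    using c t by (simp add: powr_mult)
  also have "\<dots> = c * exp (- (c * t))"
    unfolding powr_add[symmetric] using c t by simp
  finally have *: "c * exp (- (c * t)) \<le> t powr (\<nu> - 1) * c powr \<nu>" by simp
  have "\<bar>A (S t x) \<bullet> e\<bar> = c * exp (- (c * t)) * \<bar>x \<bullet> e\<bar>"
    unfolding inner_A_S[OF e t, of x] c_def[symmetric] using c by (simp add: abs_mult)
  also have "\<dots> \<le> t powr (\<nu> - 1) * c powr \<nu> * \<bar>x \<bullet> e\<bar>"
    by (rule mult_right_mono[OF *]) simp
  also have "\<dots> = t powr (\<nu> - 1) * \<bar>y \<bullet> e\<bar>"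
    using coef[OF e] by (simp add: abs_mult c_def)
  finally show "\<bar>A (S t x) \<bullet> e\<bar> \<le> t powr (\<nu> - 1) * \<bar>y \<bullet> e\<bar>" .
qed simp

lemma norm_A_S_le_frac_power:
  assumes "t > 0" "0 \<le> \<nu>" "\<nu> \<le> 1" "x \<in> frac_dom D (\<lambda>x. - A x) \<nu>"
  shows "norm (A (S t x)) \<le> t powr (\<nu> - 1) * norm (frac_power D (\<lambda>x. - A x) \<nu> x)"
  by (rule norm_A_S_le) (use assms inner_frac_power[OF self_adjoint eigenbasis] in auto)

text \<open>The domain of a fractional power embeds into H since the eigenvalues are bounded away
  from 0.\<close>

lemma norm_le_frac_power:
  assumes \<nu>: "0 \<le> \<nu>" and x: "x \<in> frac_dom D (\<lambda>x. - A x) \<nu>"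
  shows "norm x \<le> lam powr (- \<nu>) * norm (frac_power D (\<lambda>x. - A x) \<nu> x)"
proof (rule norm_le_of_coefficients_le[OF basis])
  fix e assume e: "e \<in> E"
  have "1 = lam powr (- \<nu>) * lam powr \<nu>"
    using lam_pos by (simp flip: powr_add)
  also have "\<dots> \<le> lam powr (- \<nu>) * eigenvalue e powr \<nu>"
    using eigenvalue_ge[OF e] lam_pos \<nu> by (intro mult_left_mono powr_mono2) auto
  finally have "1 * \<bar>x \<bullet> e\<bar> \<le> lam powr (- \<nu>) * eigenvalue e powr \<nu> * \<bar>x \<bullet> e\<bar>"
    by (rule mult_right_mono) simp
  then show "\<bar>x \<bullet> e\<bar> \<le> lam powr (- \<nu>) * \<bar>frac_power D (\<lambda>x. - A x) \<nu> x \<bullet> e\<bar>"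
    by (simp add: inner_frac_power[OF self_adjoint eigenbasis x e] abs_mult)
qed simp

lemma continuous_on_S: "continuous_on {0..} (\<lambda>t. S t x)"
  unfolding continuous_on_def
proof
  fix t :: real assume t: "t \<in> {0..}"
  show "((\<lambda>t. S t x) \<longlongrightarrow> S t x) (at t within {0..})"
  proof (cases "t = 0")
    case True
    then show ?thesis
      using semigroup(1) unfolding C0_semigroup_def by (simp add: at_within_Ici_at_right)
  next
    case False
    then have "isCont (\<lambda>t. S t x) t"
      using t by (intro has_vector_derivative_continuous[OF S_derivative(2)]) simp
    then show ?thesis
      unfolding isCont_def by (rule tendsto_within_subset) simp
  qed
qed

lemma norm_S_le:
  assumes t: "t > 0"
  shows "norm (S t x) \<le> norm x"
proof -
  have "norm (S t) \<le> exp (- lam * t)" by (rule decay[OF t])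
  also have "\<dots> \<le> 1" using t lam_pos by simp
  finally have "norm (S t) * norm x \<le> 1 * norm x" by (rule mult_right_mono) simp
  with norm_blinfun[of "S t" x] show ?thesis by simp
qed

lemma convolution_kernel_S: "convolution_kernel (\<lambda>t x. S t x)"
  by (rule convolution_kernelI[where b = "\<lambda>_. 1"])
    (auto simp: norm_S_le intro: continuous_on_subset[OF continuous_on_S]
      blinfun.bounded_linear_right bounded_linear.linear)

text \<open>For continuity in t at a point, a piece S(\<delta>) is split off: A S(s) x = S(s - \<delta>) A S(\<delta>) x for
  s > \<delta>, and the orbit of the fixed vector A S(\<delta>) x is continuous.\<close>

lemma convolution_kernel_A_S: "convolution_kernel (\<lambda>t x. A (S t x))"
proof (rule convolution_kernelI[where b = "\<lambda>t. t powr (0 - 1)"])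
  show "continuous_on {0<..} (\<lambda>t. A (S t x))" for x
  proof (rule continuous_at_imp_continuous_on, intro ballI)
    fix t :: real assume "t \<in> {0<..}"
    define \<delta> where "\<delta> = t / 2"
    have \<delta>: "0 < \<delta>" "\<delta> < t" using \<open>t \<in> {0<..}\<close> by (simp_all add: \<delta>_def)
    have "isCont (\<lambda>s. S (s - \<delta>) (A (S \<delta> x))) t"
    proof (rule isCont_o2[where f = "\<lambda>s. s - \<delta>"])
      show "isCont (\<lambda>s. S s (A (S \<delta> x))) (t - \<delta>)"
        using \<delta> by (intro has_vector_derivative_continuous[OF S_derivative(2)]) simp
    qed simp
    moreover have "\<forall>\<^sub>F s in nhds t. S (s - \<delta>) (A (S \<delta> x)) = A (S s x)"
    proof (rule eventually_nhds_in_open[of "{\<delta><..}", THEN eventually_mono])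
      fix s assume "s \<in> {\<delta><..}"
      then show "S (s - \<delta>) (A (S \<delta> x)) = A (S s x)"
        using \<delta> by (intro eq_of_coefficients_eq[OF basis])
          (simp add: inner_S inner_A_S right_diff_distrib flip: exp_add mult.assoc)
    qed (use \<delta> in auto)
    ultimately show "isCont (\<lambda>t. A (S t x)) t"
      by (simp add: isCont_cong)
  qed
  show "norm (A (S t x)) \<le> t powr (0 - 1) * norm x" if "t > 0" for t x
    by (rule norm_A_S_le) (use that eigenvalue_ge lam_pos in force)+
qed (auto simp: linear_A_S intro!: continuous_intros)

lemma norm_A_S_blinfun_le:
  assumes L: "L \<in> frac_blinfuns D (\<lambda>x. - A x) \<nu>" and t: "t > 0" and \<nu>: "0 \<le> \<nu>" "\<nu> \<le> 1"
  shows "norm (A (S t (blinfun_apply L v)))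
    \<le> frac_blinfun_norm D (\<lambda>x. - A x) \<nu> L * norm v * t powr (\<nu> - 1)"
proof -
  have "blinfun_apply L v \<in> frac_dom D (\<lambda>x. - A x) \<nu>"
    using L unfolding frac_blinfuns_def by blast
  then have "norm (A (S t (blinfun_apply L v)))
      \<le> t powr (\<nu> - 1) * norm (frac_power D (\<lambda>x. - A x) \<nu> (blinfun_apply L v))"
    by (rule norm_A_S_le_frac_power[OF t \<nu>])
  also have "\<dots> \<le> t powr (\<nu> - 1) * (frac_blinfun_norm D (\<lambda>x. - A x) \<nu> L * norm v)"
    by (rule mult_left_mono[OF frac_blinfun_norm[OF L]]) simp
  finally show ?thesis by (simp only: mult.commute)
qed

lemma norm_blinfun_le_frac:
  assumes L: "L \<in> frac_blinfuns D (\<lambda>x. - A x) \<nu>" and \<nu>: "0 \<le> \<nu>"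
  shows "norm L \<le> lam powr (- \<nu>) * frac_blinfun_norm D (\<lambda>x. - A x) \<nu> L"
proof (rule norm_blinfun_bound)
  show "0 \<le> lam powr (- \<nu>) * frac_blinfun_norm D (\<lambda>x. - A x) \<nu> L"
    by (simp add: frac_blinfun_norm_nonneg[OF L])
  fix v
  have "blinfun_apply L v \<in> frac_dom D (\<lambda>x. - A x) \<nu>"
    using L unfolding frac_blinfuns_def by blast
  then have "norm (blinfun_apply L v)
      \<le> lam powr (- \<nu>) * norm (frac_power D (\<lambda>x. - A x) \<nu> (blinfun_apply L v))"
    by (rule norm_le_frac_power[OF \<nu>])
  also have "\<dots> \<le> lam powr (- \<nu>) * (frac_blinfun_norm D (\<lambda>x. - A x) \<nu> L * norm v)"
    by (rule mult_left_mono[OF frac_blinfun_norm[OF L]]) simp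
  finally show "norm (blinfun_apply L v)
      \<le> lam powr (- \<nu>) * frac_blinfun_norm D (\<lambda>x. - A x) \<nu> L * norm v"
    by (simp only: mult.assoc)
qed

end

section \<open>Convolutions with weakly singular kernels\<close>

lemma powr_from_0_lborel:
  fixes \<alpha> T :: real
  assumes \<alpha>: "\<alpha> > 0" and T: "T \<ge> 0"
  shows "set_integrable lborel {0..T} (\<lambda>s. s powr (\<alpha> - 1))"
    and "(LINT s:{0..T}|lborel. s powr (\<alpha> - 1)) = T powr \<alpha> / \<alpha>"
proof -
  have hi: "((\<lambda>s. s powr (\<alpha> - 1)) has_integral (T powr \<alpha> / \<alpha>)) {0..T}"
    using has_integral_powr_from_0[of "\<alpha> - 1" T] \<alpha> T by simp
  then have "(\<lambda>s. s powr (\<alpha> - 1)) absolutely_integrable_on {0..T}"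
    by (intro nonnegative_absolutely_integrable_1) (auto simp: integrable_on_def)
  then show int: "set_integrable lborel {0..T} (\<lambda>s. s powr (\<alpha> - 1))"
    unfolding set_integrable_def by (subst (asm) integrable_completion) auto
  show "(LINT s:{0..T}|lborel. s powr (\<alpha> - 1)) = T powr \<alpha> / \<alpha>"
    using set_borel_integral_eq_integral(2)[OF int] integral_unique[OF hi] by simp
qed

definition convolution ::
  "(real \<Rightarrow> 'h \<Rightarrow> 'h) \<Rightarrow> (real \<Rightarrow> 'h) \<Rightarrow> real \<Rightarrow> 'h::{banach,second_countable_topology}" where
  "convolution \<Phi> y t = (LINT r:{0..t}|lborel. \<Phi> (t - r) (y r))"

text \<open>The exponent is written \<alpha> - 1 because the integral of s powr (\<alpha> - 1) over [0, T] is
  T powr \<alpha> / \<alpha>. The bound is asked of the kernel applied to the values of y, not of the operator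
  norm of the kernel: for A S(s) it
  expresses the fractional smoothness of the values.\<close>

definition weakly_singular ::
  "(real \<Rightarrow> 'h \<Rightarrow> 'h) \<Rightarrow> real \<Rightarrow> real \<Rightarrow> (real \<Rightarrow> 'h::real_normed_vector) \<Rightarrow> real \<Rightarrow> bool" where
  "weakly_singular \<Phi> \<alpha> T y C \<longleftrightarrow>
     (\<forall>s>0. \<forall>r\<in>{0..T}. norm (\<Phi> s (y r)) \<le> C * s powr (\<alpha> - 1))"

lemma convolution_0 [simp]: "convolution \<Phi> y 0 = 0"
  unfolding convolution_def set_lebesgue_integral_def
proof (rule integral_eq_zero_AE)
  show "AE r in lborel. indicator {0..0} r *\<^sub>R \<Phi> (0 - r) (y r) = 0"
    using AE_lborel_singleton[of 0] by eventually_elim simp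
qed

context
  fixes \<Phi> :: "real \<Rightarrow> 'h \<Rightarrow> 'h::{banach,second_countable_topology}" and \<alpha> T :: real
  assumes \<Phi>: "convolution_kernel \<Phi>" and \<alpha>: "\<alpha> > 0" and T: "T \<ge> 0"
begin

lemma convolution_integrable:
  assumes y: "continuous_on {0..T} y" and sing: "weakly_singular \<Phi> \<alpha> T y C" and t: "t \<in> {0..T}"
  shows "set_integrable lborel {0<..t} (\<lambda>s. \<Phi> s (y (t - s)))"
proof (rule set_integrable_bound)
  show "set_integrable lborel {0<..t} (\<lambda>s. C * s powr (\<alpha> - 1))"
  proof (rule set_integrable_subset)
    show "set_integrable lborel {0..T} (\<lambda>s. C * s powr (\<alpha> - 1))"
      using powr_from_0_lborel(1)[OF \<alpha> T] by simp
  qed (use t in auto)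
  have "continuous_on {0<..t} (\<lambda>s. (s, y (t - s)))"
    using t by (intro continuous_intros continuous_on_compose2[OF y]) auto
  then have "continuous_on {0<..t} (\<lambda>s. case (s, y (t - s)) of (s, x) \<Rightarrow> \<Phi> s x)"
    by (rule continuous_on_compose2[OF conjunct2[OF \<Phi>[unfolded convolution_kernel_def]]]) auto
  then show "set_borel_measurable lborel {0<..t} (\<lambda>s. \<Phi> s (y (t - s)))"
    unfolding set_borel_measurable_def
    using borel_measurable_continuous_on_indicator[of "{0<..t}"] by simp
  show "AE s in lborel. s \<in> {0<..t} \<longrightarrow> norm (\<Phi> s (y (t - s))) \<le> norm (C * s powr (\<alpha> - 1))"
  proof (intro AE_I2 impI)
    fix s assume "s \<in> {0<..t}"
    then have "norm (\<Phi> s (y (t - s))) \<le> C * s powr (\<alpha> - 1)"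
      using sing t unfolding weakly_singular_def by simp
    then show "norm (\<Phi> s (y (t - s))) \<le> norm (C * s powr (\<alpha> - 1))" by simp
  qed
qed

text \<open>After the substitution s = t - r the singularity sits at s = 0 for all t. The half-open interval
  discards this point, where nothing is known about the kernel.\<close>

lemma convolution_reflect:
  assumes "continuous_on {0..T} y" "weakly_singular \<Phi> \<alpha> T y C" and t: "t \<in> {0..T}"
  shows "convolution \<Phi> y t = (LINT s:{0<..t}|lborel. \<Phi> s (y (t - s)))"
proof -
  let ?f = "\<lambda>s. \<Phi> s (y (t - s))"
  have meas: "(\<lambda>s. indicator {0<..t} s *\<^sub>R ?f s) \<in> borel_measurable lborel"
    using convolution_integrable[OF assms] unfolding set_integrable_def
    by (rule borel_measurable_integrable)
  \<comment> \<open>Measurability for the closed interval has to be derived: the value at 0 is arbitrary, but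
    it is a single value.\<close>
  have split: "(\<lambda>s. indicator {0..t} s *\<^sub>R ?f s)
      = (\<lambda>s. indicator {0<..t} s *\<^sub>R ?f s + indicator {0} s *\<^sub>R ?f 0)"
    using t by (auto simp: indicator_def)
  have "convolution \<Phi> y t = (LINT s|lborel. indicator {0..t} (t - s) *\<^sub>R ?f s)"
    unfolding convolution_def set_lebesgue_integral_def
    by (subst lborel_integral_real_affine[of "-1" _ t]) simp_all
  also have "\<dots> = (LINT s|lborel. indicator {0..t} s *\<^sub>R ?f s)"
    by (rule Bochner_Integration.integral_cong) (auto simp: indicator_def)
  also have "\<dots> = (LINT s|lborel. indicator {0<..t} s *\<^sub>R ?f s)"
  proof (rule integral_cong_AE)
    show "(\<lambda>s. indicator {0..t} s *\<^sub>R ?f s) \<in> borel_measurable lborel"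
      unfolding split using meas by (intro borel_measurable_add) simp_all
    show "AE s in lborel. indicator {0..t} s *\<^sub>R ?f s = indicator {0<..t} s *\<^sub>R ?f s"
      using AE_lborel_singleton[of 0] by eventually_elim (auto simp: indicator_def)
  qed (rule meas)
  finally show ?thesis unfolding set_lebesgue_integral_def .
qed

text \<open>In the reflected form the variable t occurs in the density and in the indicator of {0<..t}
  only. The integrands converge at every s other than the limit of t, and they are dominated by
  the integrable weight C s powr (\<alpha> - 1).\<close>

lemma continuous_on_convolution:
  assumes y: "continuous_on {0..T} y" and sing: "weakly_singular \<Phi> \<alpha> T y C"
  shows "continuous_on {0..T} (convolution \<Phi> y)"
  unfolding continuous_on_sequentially
proof (intro allI ballI impI)
  fix X :: "nat \<Rightarrow> real" and t
  assume t: "t \<in> {0..T}" and X: "(\<forall>n. X n \<in> {0..T}) \<and> X \<longlonglongrightarrow> t"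
  define h where "h t s = indicator {0<..t} s *\<^sub>R \<Phi> s (y (t - s))" for t s
  have int: "integrable lborel (h t)" if "t \<in> {0..T}" for t
    using convolution_integrable[OF y sing that] unfolding set_integrable_def h_def .
  have lim: "(\<lambda>n. h (X n) s) \<longlonglongrightarrow> h t s" if "s \<noteq> t" for s
  proof (cases "0 < s \<and> s < t")
    case True
    have "(\<lambda>n. X n - s) \<longlonglongrightarrow> t - s" using X by (intro tendsto_intros) auto
    moreover have ev: "\<forall>\<^sub>F n in sequentially. s < X n"
      using True X by (intro order_tendstoD(1)[of X t]) auto
    then have "\<forall>\<^sub>F n in sequentially. X n - s \<in> {0..T}"
      by eventually_elim (use X True in \<open>auto simp: less_imp_le add_increasing2 diff_le_eq\<close>)
    ultimately have "(\<lambda>n. y (X n - s)) \<longlonglongrightarrow> y (t - s)"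
      using True t by (intro continuous_on_tendsto_compose[OF y, of _ _ sequentially]) auto
    moreover have "continuous_on UNIV (\<lambda>x. case (s, x) of (s, x) \<Rightarrow> \<Phi> s x)"
      using True by (intro continuous_on_compose2[OF conjunct2[OF \<Phi>[unfolded convolution_kernel_def]]]
          continuous_on_Pair continuous_on_const continuous_on_id) auto
    then have "continuous_on UNIV (\<Phi> s)" by simp
    ultimately have "(\<lambda>n. \<Phi> s (y (X n - s))) \<longlonglongrightarrow> \<Phi> s (y (t - s))"
      by (intro continuous_on_tendsto_compose[where f = "\<Phi> s" and s = UNIV]) simp_all
    moreover have "\<forall>\<^sub>F n in sequentially. h (X n) s = \<Phi> s (y (X n - s))"
      using ev by eventually_elim (use True in \<open>auto simp: h_def\<close>)
    moreover have "h t s = \<Phi> s (y (t - s))"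
      using True by (simp add: h_def)
    ultimately show ?thesis
      by (simp add: tendsto_cong)
  next
    case False
    have "\<forall>\<^sub>F n in sequentially. h (X n) s = 0"
    proof (cases "s \<le> 0")
      case True
      then show ?thesis by (simp add: h_def)
    next
      case False
      with \<open>\<not> (0 < s \<and> s < t)\<close> that have "t < s" by auto
      then have "\<forall>\<^sub>F n in sequentially. X n < s"
        using X by (intro order_tendstoD(2)[of X t]) auto
      then show ?thesis by eventually_elim (simp add: h_def)
    qed
    moreover have "h t s = 0" using False that by (auto simp: h_def)
    ultimately show ?thesis by (simp add: tendsto_eventually)
  qed
  have "(\<lambda>n. integral\<^sup>L lborel (h (X n))) \<longlonglongrightarrow> integral\<^sup>L lborel (h t)"
  proof (rule integral_dominated_convergence)
    show "integrable lborel (\<lambda>s. indicator {0..T} s *\<^sub>R (\<bar>C\<bar> * s powr (\<alpha> - 1)))"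
      using powr_from_0_lborel(1)[OF \<alpha> T] unfolding set_integrable_def[symmetric] by simp
    show "AE s in lborel. (\<lambda>n. h (X n) s) \<longlonglongrightarrow> h t s"
      using AE_lborel_singleton[of t] by eventually_elim (rule lim)
    show "AE s in lborel. norm (h (X n) s) \<le> indicator {0..T} s *\<^sub>R (\<bar>C\<bar> * s powr (\<alpha> - 1))" for n
    proof (rule AE_I2)
      fix s
      show "norm (h (X n) s) \<le> indicator {0..T} s *\<^sub>R (\<bar>C\<bar> * s powr (\<alpha> - 1))"
      proof (cases "s \<in> {0<..X n}")
        case True
        have "X n \<in> {0..T}" using X by blast
        with True have "norm (\<Phi> s (y (X n - s))) \<le> C * s powr (\<alpha> - 1)"
          using sing unfolding weakly_singular_def by simp
        also have "\<dots> \<le> \<bar>C\<bar> * s powr (\<alpha> - 1)" by (simp add: mult_right_mono)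
        finally show ?thesis using True \<open>X n \<in> {0..T}\<close> by (simp add: h_def)
      qed (simp add: h_def)
    qed
  qed (use int t X in \<open>auto intro: borel_measurable_integrable\<close>)
  moreover have "convolution \<Phi> y t = integral\<^sup>L lborel (h t)" if "t \<in> {0..T}" for t
    unfolding convolution_reflect[OF y sing that] set_lebesgue_integral_def h_def ..
  ultimately show "(convolution \<Phi> y \<circ> X) \<longlonglongrightarrow> convolution \<Phi> y t"
    using X t by (simp add: comp_def)
qed

lemma norm_convolution_diff_le:
  assumes y: "continuous_on {0..T} y" "weakly_singular \<Phi> \<alpha> T y C"
    and z: "continuous_on {0..T} z" "weakly_singular \<Phi> \<alpha> T z C'"
    and diff: "\<And>s r. s > 0 \<Longrightarrow> r \<in> {0..T} \<Longrightarrow>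
      norm (\<Phi> s (y r) - \<Phi> s (z r)) \<le> M * s powr (\<alpha> - 1)"
    and M: "M \<ge> 0" and t: "t \<in> {0..T}"
  shows "norm (convolution \<Phi> y t - convolution \<Phi> z t) \<le> M * (T powr \<alpha> / \<alpha>)"
proof -
  note int = convolution_integrable[OF y t] convolution_integrable[OF z t]
  have "norm (convolution \<Phi> y t - convolution \<Phi> z t)
      = norm (LINT s:{0<..t}|lborel. \<Phi> s (y (t - s)) - \<Phi> s (z (t - s)))"
    unfolding convolution_reflect[OF y t] convolution_reflect[OF z t]
    using set_integral_diff(2)[OF int] by simp
  also have "\<dots> \<le> (LINT s:{0..T}|lborel. M * s powr (\<alpha> - 1))"
    unfolding set_lebesgue_integral_def
  proof (rule Bochner_Integration.integral_norm_bound_integral)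
    show "integrable lborel (\<lambda>s. indicator {0<..t} s *\<^sub>R (\<Phi> s (y (t - s)) - \<Phi> s (z (t - s))))"
      using set_integral_diff(1)[OF int] unfolding set_integrable_def .
    show "integrable lborel (\<lambda>s. indicator {0..T} s *\<^sub>R (M * s powr (\<alpha> - 1)))"
      using powr_from_0_lborel(1)[OF \<alpha> T] unfolding set_integrable_def[symmetric] by simp
    fix s :: real
    show "norm (indicator {0<..t} s *\<^sub>R (\<Phi> s (y (t - s)) - \<Phi> s (z (t - s))))
        \<le> indicator {0..T} s *\<^sub>R (M * s powr (\<alpha> - 1))"
      using diff[of s "t - s"] t M by (auto simp: indicator_def)
  qed
  also have "\<dots> = M * (T powr \<alpha> / \<alpha>)"
    using powr_from_0_lborel(2)[OF \<alpha> T] by simp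
  finally show ?thesis .
qed

end

section \<open>Path spaces and segments\<close>

lemma mspace_path_space:
  "u \<in> mspace (path_space a b) \<longleftrightarrow> u \<in> extensional {a..b} \<and> continuous_on {a..b} u"
  unfolding path_space_def
  by (subst compactin_mspace_cfunspace) (auto simp: compactin_subtopology)

lemma mdist_path_space_le:
  assumes "0 \<le> B" "\<And>t. t \<in> {a..b} \<Longrightarrow> dist (u t) (v t) \<le> B"
  shows "mdist (path_space a b) u v \<le> B"
  unfolding path_space_def by (rule mdist_cfunspace_le) (use assms in auto)

lemma dist_le_mdist_path_space:
  assumes "u \<in> mspace (path_space a b)" "v \<in> mspace (path_space a b)" "t \<in> {a..b}"
  shows "dist (u t) (v t) \<le> mdist (path_space a b) u v"
  using mdist_cfunspace_imp_mdist_le[of u "top_of_set {a..b}" euclidean_metric v _ t] assms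
  unfolding path_space_def by simp

lemma mcomplete_path_space:
  "mcomplete_of (path_space a b :: (real \<Rightarrow> 'h::complete_space) metric)"
proof -
  have "mcomplete_of (cfunspace (top_of_set {a..b}) (Met_TC.Self :: 'h metric))"
    by (rule Met_TC.mcomplete_cfunspace) (simp add: mcomplete_iff_complete complete_UNIV)
  then show ?thesis by (simp add: path_space_def euclidean_metric_def Met_TC.Self_def)
qed

lemma restrict_in_path_space:
  "continuous_on {a..b} u \<Longrightarrow> restrict u {a..b} \<in> mspace (path_space a b)"
  unfolding mspace_path_space
  by (rule conjI[OF restrict_extensional]) (rule continuous_on_cong[THEN iffD1], simp_all)

text \<open>One integral term of a delay equation: a kernel \<Phi> acts on a density N that depends on the
  current segment and on time. The Lipschitz condition concerns \<Phi> s composed with N, in the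
  weakly singular norm, for the reason given at \<open>weakly_singular\<close>.\<close>

definition singular_Lipschitz ::
  "real \<Rightarrow> real \<Rightarrow> (real \<Rightarrow> 'h \<Rightarrow> 'h) \<Rightarrow> real \<Rightarrow>
    ((real \<Rightarrow> 'h) \<Rightarrow> real \<Rightarrow> 'h::real_normed_vector) \<Rightarrow> real \<Rightarrow> bool" where
  "singular_Lipschitz \<mu> T \<Phi> \<alpha> N L \<longleftrightarrow>
     (\<forall>u\<in>mspace (path_space (-\<mu>) T). continuous_on {0..T} (\<lambda>r. N (segment \<mu> u r) r)) \<and>
     (\<forall>x\<in>mspace (path_space (-\<mu>) 0). \<exists>C. weakly_singular \<Phi> \<alpha> T (N x) C) \<and>
     (\<forall>x\<in>mspace (path_space (-\<mu>) 0). \<forall>y\<in>mspace (path_space (-\<mu>) 0). \<forall>s>0. \<forall>r\<in>{0..T}.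
        norm (\<Phi> s (N x r) - \<Phi> s (N y r)) \<le> L * mdist (path_space (-\<mu>) 0) x y * s powr (\<alpha> - 1))"

context
  fixes \<mu> T :: real
  assumes \<mu>: "\<mu> \<ge> 0" and T: "T \<ge> 0"
begin

lemma segment_in_path_space:
  assumes u: "u \<in> mspace (path_space (-\<mu>) T)" and t: "t \<in> {0..T}"
  shows "segment \<mu> u t \<in> mspace (path_space (-\<mu>) 0)"
proof -
  have "continuous_on {-\<mu>..0} (\<lambda>s. u (t + s))"
    using u t unfolding mspace_path_space
    by (intro continuous_on_compose2[of "{-\<mu>..T}" u _ "\<lambda>s. t + s"] continuous_on_add
        continuous_on_const continuous_on_id) auto
  then show ?thesis
    unfolding segment_def by (rule restrict_in_path_space)
qed

lemma mdist_segment_le: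
  assumes u: "u \<in> mspace (path_space (-\<mu>) T)" and v: "v \<in> mspace (path_space (-\<mu>) T)"
    and t: "t \<in> {0..T}"
  shows "mdist (path_space (-\<mu>) 0) (segment \<mu> u t) (segment \<mu> v t) \<le> mdist (path_space (-\<mu>) T) u v"
proof (rule mdist_path_space_le)
  fix s assume "s \<in> {-\<mu>..0}"
  then show "dist (segment \<mu> u t s) (segment \<mu> v t s) \<le> mdist (path_space (-\<mu>) T) u v"
    using dist_le_mdist_path_space[OF u v, of "t + s"] t by (simp add: segment_def)
qed simp

lemma mdist_segment_bounded:
  assumes u: "u \<in> mspace (path_space (-\<mu>) T)"
  shows "\<exists>B. \<forall>t\<in>{0..T}. mdist (path_space (-\<mu>) 0) (segment \<mu> u t) (segment \<mu> u 0) \<le> B"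
proof -
  have "bounded (u ` {-\<mu>..T})"
    using u unfolding mspace_path_space
    by (intro compact_imp_bounded compact_continuous_image) auto
  then obtain B where "\<forall>s\<in>{-\<mu>..T}. \<forall>t\<in>{-\<mu>..T}. dist (u s) (u t) \<le> B"
    unfolding bounded_two_points by auto
  then have B: "dist (u s) (u t) \<le> B" if "s \<in> {-\<mu>..T}" "t \<in> {-\<mu>..T}" for s t
    using that by blast
  have "B \<ge> 0" using B[of 0 0] \<mu> T by simp
  show ?thesis
  proof (intro exI ballI)
    fix t assume "t \<in> {0..T}"
    with B \<open>B \<ge> 0\<close> \<mu> T show "mdist (path_space (-\<mu>) 0) (segment \<mu> u t) (segment \<mu> u 0) \<le> B"
      by (intro mdist_path_space_le) (auto simp: segment_def)
  qed
qed

text \<open>Uniform continuity of u makes the segment a continuous curve in the path space over the delay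
  interval. This is why Lipschitz nonlinearities yield continuous densities.\<close>

lemma mdist_segment_small:
  assumes u: "u \<in> mspace (path_space (-\<mu>) T)" and \<epsilon>: "\<epsilon> > 0"
  shows "\<exists>\<delta>>0. \<forall>s\<in>{0..T}. \<forall>t\<in>{0..T}. dist s t < \<delta> \<longrightarrow>
    mdist (path_space (-\<mu>) 0) (segment \<mu> u s) (segment \<mu> u t) \<le> \<epsilon>"
proof -
  have "uniformly_continuous_on {-\<mu>..T} u"
    using u unfolding mspace_path_space by (intro compact_uniformly_continuous) auto
  then obtain \<delta> where "\<delta> > 0"
    and "\<forall>t\<in>{-\<mu>..T}. \<forall>s\<in>{-\<mu>..T}. dist s t < \<delta> \<longrightarrow> dist (u s) (u t) < \<epsilon>"
    using \<epsilon> unfolding uniformly_continuous_on_def by blast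
  then have \<delta>: "dist (u s) (u t) < \<epsilon>"
    if "s \<in> {-\<mu>..T}" "t \<in> {-\<mu>..T}" "dist s t < \<delta>" for s t
    using that by blast
  show ?thesis
  proof (intro exI[of _ \<delta>] conjI ballI impI)
    fix s t assume st: "s \<in> {0..T}" "t \<in> {0..T}" "dist s t < \<delta>"
    show "mdist (path_space (-\<mu>) 0) (segment \<mu> u s) (segment \<mu> u t) \<le> \<epsilon>"
    proof (rule mdist_path_space_le)
      fix r assume "r \<in> {-\<mu>..0}"
      then show "dist (segment \<mu> u s r) (segment \<mu> u t r) \<le> \<epsilon>"
        using \<delta>[of "s + r" "t + r"] st by (simp add: segment_def dist_real_def)
    qed (use \<epsilon> in simp)
  qed fact
qed

lemma continuous_on_Lipschitz_segment:
  fixes f :: "(real \<Rightarrow> 'h::metric_space) \<Rightarrow> 'b::metric_space"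
  assumes f: "\<And>x y. x \<in> mspace (path_space (-\<mu>) 0) \<Longrightarrow> y \<in> mspace (path_space (-\<mu>) 0) \<Longrightarrow>
      dist (f x) (f y) \<le> L * mdist (path_space (-\<mu>) 0) x y" and L: "L \<ge> 0"
    and u: "u \<in> mspace (path_space (-\<mu>) T)"
  shows "continuous_on {0..T} (\<lambda>t. f (segment \<mu> u t))"
  unfolding continuous_on_iff
proof (intro ballI allI impI)
  fix t \<epsilon> :: real assume t: "t \<in> {0..T}" and "\<epsilon> > 0"
  then have "\<epsilon> / (L + 1) > 0" using L by simp
  from mdist_segment_small[OF u this] obtain \<delta> where "\<delta> > 0"
    and small: "\<forall>s\<in>{0..T}. \<forall>t\<in>{0..T}. dist s t < \<delta> \<longrightarrow>
      mdist (path_space (-\<mu>) 0) (segment \<mu> u s) (segment \<mu> u t) \<le> \<epsilon> / (L + 1)"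
    by (elim exE conjE)
  have \<delta>: "mdist (path_space (-\<mu>) 0) (segment \<mu> u s) (segment \<mu> u t) \<le> \<epsilon> / (L + 1)"
    if "s \<in> {0..T}" "dist s t < \<delta>" for s
    using small that t by blast
  have "dist (f (segment \<mu> u s)) (f (segment \<mu> u t)) < \<epsilon>" if s: "s \<in> {0..T}" "dist s t < \<delta>" for s
  proof -
    have "dist (f (segment \<mu> u s)) (f (segment \<mu> u t))
        \<le> L * mdist (path_space (-\<mu>) 0) (segment \<mu> u s) (segment \<mu> u t)"
      using segment_in_path_space[OF u] s t by (intro f) auto
    also have "\<dots> \<le> L * (\<epsilon> / (L + 1))"
      using \<delta>[OF s] L by (rule mult_left_mono)
    also have "\<dots> < \<epsilon>" using L \<open>\<epsilon> > 0\<close> by (simp add: field_simps)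
    finally show ?thesis .
  qed
  then show "\<exists>d>0. \<forall>s\<in>{0..T}. dist s t < d \<longrightarrow>
      dist (f (segment \<mu> u s)) (f (segment \<mu> u t)) < \<epsilon>"
    by (intro exI[of _ \<delta>] conjI ballI impI \<open>\<delta> > 0\<close>)
qed

section \<open>Fixed points of delay equations\<close>

text \<open>The fixed point map \<Gamma> prescribes \<xi> on the past and V \<xi> u on [0, T]. It acts on the whole path
  space over [-\<mu>, T], not only on the paths that extend \<xi>: paths with a wrong past are
  corrected in one step, and the two branches of \<Gamma> fit together at 0 by the assumption on V \<xi> u 0.
  In this way all \<xi> share one complete space, and the Lipschitz estimate for
  solutions with different initial segments is the same computation as uniqueness.\<close>

lemma delay_equation_wellposed:
  fixes V :: "(real \<Rightarrow> 'h::complete_space) \<Rightarrow> (real \<Rightarrow> 'h) \<Rightarrow> real \<Rightarrow> 'h"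
  defines "X \<equiv> path_space (-\<mu>) 0 :: (real \<Rightarrow> 'h) metric"
    and "Y \<equiv> path_space (-\<mu>) T :: (real \<Rightarrow> 'h) metric"
  assumes cont: "\<And>\<xi> u. \<xi> \<in> mspace X \<Longrightarrow> u \<in> mspace Y \<Longrightarrow> continuous_on {0..T} (V \<xi> u)"
    and init: "\<And>\<xi> u. \<xi> \<in> mspace X \<Longrightarrow> u \<in> mspace Y \<Longrightarrow> V \<xi> u 0 = \<xi> 0"
    and contr: "\<And>\<xi> \<eta> u v t. \<xi> \<in> mspace X \<Longrightarrow> \<eta> \<in> mspace X \<Longrightarrow> u \<in> mspace Y \<Longrightarrow> v \<in> mspace Y \<Longrightarrow>
      t \<in> {0..T} \<Longrightarrow> dist (V \<xi> u t) (V \<eta> v t) \<le> mdist X \<xi> \<eta> + mdist Y u v / 2"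
    and sol: "\<And>\<xi> u. sol \<xi> u \<longleftrightarrow>
      u \<in> mspace Y \<and> (\<forall>t\<in>{-\<mu>..0}. u t = \<xi> t) \<and> (\<forall>t\<in>{0..T}. u t = V \<xi> u t)"
  shows "\<forall>\<xi>\<in>mspace X. \<exists>!u. sol \<xi> u"
    and "continuous_map (mtopology_of X) (mtopology_of Y) (\<lambda>\<xi>. THE u. sol \<xi> u)"
proof -
  define \<Gamma> where "\<Gamma> \<xi> u = (\<lambda>t\<in>{-\<mu>..T}. if t \<le> 0 then \<xi> t else V \<xi> u t)" for \<xi> u
  have \<Gamma>_in: "\<Gamma> \<xi> u \<in> mspace Y" if \<xi>: "\<xi> \<in> mspace X" and u: "u \<in> mspace Y" for \<xi> u
  proof -
    have "continuous_on {-\<mu>..0} \<xi>" using \<xi> unfolding X_def mspace_path_space by blast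
    then have "continuous_on ({-\<mu>..0} \<union> {0..T}) (\<lambda>t. if t \<le> 0 then \<xi> t else V \<xi> u t)"
    proof (rule continuous_on_cases[OF closed_atLeastAtMost closed_atLeastAtMost _ cont[OF \<xi> u]])
      have "t = 0" if "t \<in> {0..T}" "t \<le> 0" for t using that by simp
      then show "\<forall>t. t \<in> {-\<mu>..0} \<and> \<not> t \<le> 0 \<or> t \<in> {0..T} \<and> t \<le> 0 \<longrightarrow> \<xi> t = V \<xi> u t"
        using init[OF \<xi> u] by force
    qed
    moreover have "{-\<mu>..0} \<union> {0..T} = {-\<mu>..T}" using \<mu> T by auto
    ultimately show ?thesis
      unfolding Y_def \<Gamma>_def by (intro restrict_in_path_space) simp
  qed
  have \<Gamma>_contr: "mdist Y (\<Gamma> \<xi> u) (\<Gamma> \<eta> v) \<le> mdist X \<xi> \<eta> + mdist Y u v / 2"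
    if "\<xi> \<in> mspace X" "\<eta> \<in> mspace X" "u \<in> mspace Y" "v \<in> mspace Y" for \<xi> \<eta> u v
  proof -
    have "dist (\<Gamma> \<xi> u t) (\<Gamma> \<eta> v t) \<le> mdist X \<xi> \<eta> + mdist Y u v / 2" if t: "t \<in> {-\<mu>..T}" for t
    proof (cases "t \<le> 0")
      case True
      then have "dist (\<xi> t) (\<eta> t) \<le> mdist X \<xi> \<eta>"
        using t \<open>\<xi> \<in> mspace X\<close> \<open>\<eta> \<in> mspace X\<close> unfolding X_def
        by (intro dist_le_mdist_path_space) auto
      also have "\<dots> \<le> mdist X \<xi> \<eta> + mdist Y u v / 2" by simp
      finally show ?thesis using True t by (simp add: \<Gamma>_def)
    next
      case False
      then show ?thesis
        using contr[of \<xi> \<eta> u v t] \<open>\<xi> \<in> mspace X\<close> \<open>\<eta> \<in> mspace X\<close> \<open>u \<in> mspace Y\<close> \<open>v \<in> mspace Y\<close> t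
        by (simp add: \<Gamma>_def)
    qed
    then show ?thesis
      unfolding Y_def by (intro mdist_path_space_le) simp_all
  qed
  have sol_iff: "sol \<xi> u \<longleftrightarrow> u \<in> mspace Y \<and> \<Gamma> \<xi> u = u" if \<xi>: "\<xi> \<in> mspace X" for \<xi> u
  proof (cases "u \<in> mspace Y")
    case True
    then have ext: "u \<in> extensional {-\<mu>..T}" unfolding Y_def mspace_path_space by blast
    have "\<Gamma> \<xi> u = u \<longleftrightarrow> (\<forall>t\<in>{-\<mu>..T}. u t = (if t \<le> 0 then \<xi> t else V \<xi> u t))"
    proof
      assume fp: "\<Gamma> \<xi> u = u"
      show "\<forall>t\<in>{-\<mu>..T}. u t = (if t \<le> 0 then \<xi> t else V \<xi> u t)"
      proof
        fix t assume "t \<in> {-\<mu>..T}"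
        then show "u t = (if t \<le> 0 then \<xi> t else V \<xi> u t)"
          using fun_cong[OF fp, of t] unfolding \<Gamma>_def by simp
      qed
    next
      assume "\<forall>t\<in>{-\<mu>..T}. u t = (if t \<le> 0 then \<xi> t else V \<xi> u t)"
      then show "\<Gamma> \<xi> u = u"
        unfolding \<Gamma>_def by (intro extensionalityI[OF restrict_extensional ext]) simp
    qed
    also have "\<dots> \<longleftrightarrow> (\<forall>t\<in>{-\<mu>..0}. u t = \<xi> t) \<and> (\<forall>t\<in>{0..T}. u t = V \<xi> u t)"
    proof (intro iffI conjI ballI)
      fix t assume *: "\<forall>t\<in>{-\<mu>..T}. u t = (if t \<le> 0 then \<xi> t else V \<xi> u t)"
      show "u t = \<xi> t" if "t \<in> {-\<mu>..0}" using * that T by auto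
      show "u t = V \<xi> u t" if "t \<in> {0..T}"
        using * that \<mu> init[OF \<xi> True] by (cases "t = 0") auto
    next
      fix t assume *: "(\<forall>t\<in>{-\<mu>..0}. u t = \<xi> t) \<and> (\<forall>t\<in>{0..T}. u t = V \<xi> u t)" "t \<in> {-\<mu>..T}"
      then show "u t = (if t \<le> 0 then \<xi> t else V \<xi> u t)" by auto
    qed
    finally show ?thesis using True sol by blast
  qed (simp add: sol)
  have Lip: "mdist Y u v \<le> 2 * mdist X \<xi> \<eta>"
    if "\<xi> \<in> mspace X" "\<eta> \<in> mspace X" "sol \<xi> u" "sol \<eta> v" for \<xi> \<eta> u v
    using \<Gamma>_contr[of \<xi> \<eta> u v] that sol_iff by auto
  show ex1: "\<forall>\<xi>\<in>mspace X. \<exists>!u. sol \<xi> u"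
  proof
    fix \<xi> assume \<xi>: "\<xi> \<in> mspace X"
    interpret Y: Metric_space "mspace Y" "mdist Y" by simp
    have d0: "mdist X \<xi> \<xi> = 0" using \<xi> by (simp add: mdist_zero)
    obtain u where "u \<in> mspace Y" "\<Gamma> \<xi> u = u"
    proof (rule Y.Banach_fixedpoint_thm[of "\<Gamma> \<xi>" "1/2"])
      show "Y.mcomplete"
        using mcomplete_path_space[of "-\<mu>" T] unfolding mcomplete_of_def Y_def .
      have "(\<lambda>t\<in>{-\<mu>..T}. \<xi> 0) \<in> mspace Y"
        unfolding Y_def by (intro restrict_in_path_space continuous_on_const)
      then show "mspace Y \<noteq> {}" by blast
      show "mdist Y (\<Gamma> \<xi> u) (\<Gamma> \<xi> v) \<le> 1 / 2 * mdist Y u v"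
        if "u \<in> mspace Y" "v \<in> mspace Y" for u v
        using \<Gamma>_contr[OF \<xi> \<xi> that] unfolding d0 by simp
    qed (use \<Gamma>_in \<xi> in auto)
    then have "sol \<xi> u" using sol_iff[OF \<xi>] by blast
    moreover have "v = u" if "sol \<xi> v" for v
    proof -
      have "mdist Y v u \<le> 0" using Lip[OF \<xi> \<xi> that \<open>sol \<xi> u\<close>] unfolding d0 by simp
      then have "mdist Y v u = 0" by (rule order_antisym) simp
      moreover have "v \<in> mspace Y" "u \<in> mspace Y" using that \<open>sol \<xi> u\<close> sol by blast+
      ultimately show ?thesis by (simp only: mdist_zero)
    qed
    ultimately show "\<exists>!u. sol \<xi> u" by blast
  qed
  have the_sol: "sol \<xi> (THE u. sol \<xi> u)" if "\<xi> \<in> mspace X" for \<xi>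
    by (rule theI'[OF bspec[OF ex1 that]])
  have "Lipschitz_continuous_map X Y (\<lambda>\<xi>. THE u. sol \<xi> u)"
    unfolding Lipschitz_continuous_map_def
  proof (intro conjI exI[of _ 2] ballI Pi_I)
    fix \<xi> assume \<xi>: "\<xi> \<in> mspace X"
    show "(THE u. sol \<xi> u) \<in> mspace Y"
      by (rule conjunct1[OF sol[THEN iffD1, OF the_sol[OF \<xi>]]])
    fix \<eta> assume \<eta>: "\<eta> \<in> mspace X"
    show "mdist Y (THE u. sol \<xi> u) (THE u. sol \<eta> u) \<le> 2 * mdist X \<xi> \<eta>"
      by (rule Lip[OF \<xi> \<eta> the_sol[OF \<xi>] the_sol[OF \<eta>]])
  qed
  then show "continuous_map (mtopology_of X) (mtopology_of Y) (\<lambda>\<xi>. THE u. sol \<xi> u)"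
    by (rule Lipschitz_continuous_imp_continuous_map)
qed

section \<open>Integral terms of delay equations\<close>

text \<open>The singular bound for the density along a path u follows from the one for the
  initial segment of u, because all segments of u lie within bounded distance of it.\<close>

lemma delay_convolution:
  fixes N :: "(real \<Rightarrow> 'h) \<Rightarrow> real \<Rightarrow> 'h::{banach,second_countable_topology}"
  defines "X \<equiv> path_space (-\<mu>) 0 :: (real \<Rightarrow> 'h) metric"
    and "Y \<equiv> path_space (-\<mu>) T :: (real \<Rightarrow> 'h) metric"
  assumes \<Phi>: "convolution_kernel \<Phi>" and \<alpha>: "\<alpha> > 0" and L: "L \<ge> 0"
    and N: "singular_Lipschitz \<mu> T \<Phi> \<alpha> N L"
  shows "u \<in> mspace Y \<Longrightarrow> continuous_on {0..T} (convolution \<Phi> (\<lambda>r. N (segment \<mu> u r) r))"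
    and "u \<in> mspace Y \<Longrightarrow> v \<in> mspace Y \<Longrightarrow> t \<in> {0..T} \<Longrightarrow>
      norm (convolution \<Phi> (\<lambda>r. N (segment \<mu> u r) r) t - convolution \<Phi> (\<lambda>r. N (segment \<mu> v r) r) t)
        \<le> L * (T powr \<alpha> / \<alpha>) * mdist Y u v"
proof -
  have cont: "continuous_on {0..T} (\<lambda>r. N (segment \<mu> u r) r)" if "u \<in> mspace Y" for u
    using N that unfolding singular_Lipschitz_def Y_def by blast
  have sing: "\<exists>C. weakly_singular \<Phi> \<alpha> T (N x) C" if "x \<in> mspace X" for x
    using N that unfolding singular_Lipschitz_def X_def by blast
  have Lip: "norm (\<Phi> s (N x r) - \<Phi> s (N y r)) \<le> L * mdist X x y * s powr (\<alpha> - 1)"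
    if "x \<in> mspace X" "y \<in> mspace X" "s > 0" "r \<in> {0..T}" for x y s r
    using N that unfolding singular_Lipschitz_def X_def by blast
  have seg: "segment \<mu> u r \<in> mspace X" if "u \<in> mspace Y" "r \<in> {0..T}" for u r
    using segment_in_path_space that unfolding X_def Y_def by blast
  have sing_u: "\<exists>C. weakly_singular \<Phi> \<alpha> T (\<lambda>r. N (segment \<mu> u r) r) C" if u: "u \<in> mspace Y" for u
  proof -
    define x where "x = segment \<mu> u 0"
    have x: "x \<in> mspace X" unfolding x_def using seg[OF u] T by simp
    obtain C where C: "weakly_singular \<Phi> \<alpha> T (N x) C" using sing[OF x] by blast
    obtain B where B: "\<And>r. r \<in> {0..T} \<Longrightarrow> mdist X (segment \<mu> u r) x \<le> B"
      using mdist_segment_bounded u unfolding X_def Y_def x_def by blast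
    have "norm (\<Phi> s (N (segment \<mu> u r) r)) \<le> (C + L * B) * s powr (\<alpha> - 1)"
      if s: "s > 0" and r: "r \<in> {0..T}" for s r
    proof -
      have "norm (\<Phi> s (N (segment \<mu> u r) r) - \<Phi> s (N x r))
          \<le> L * mdist X (segment \<mu> u r) x * s powr (\<alpha> - 1)"
        by (rule Lip[OF seg[OF u r] x s r])
      also have "\<dots> \<le> L * B * s powr (\<alpha> - 1)"
        by (rule mult_right_mono[OF mult_left_mono[OF B[OF r] L]]) simp
      finally have "norm (\<Phi> s (N (segment \<mu> u r) r) - \<Phi> s (N x r)) \<le> L * B * s powr (\<alpha> - 1)" .
      moreover have "norm (\<Phi> s (N x r)) \<le> C * s powr (\<alpha> - 1)"
        using C s r unfolding weakly_singular_def by blast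
      ultimately show ?thesis
        using norm_triangle_sub[of "\<Phi> s (N (segment \<mu> u r) r)" "\<Phi> s (N x r)"]
        by (simp add: distrib_right)
    qed
    then show ?thesis unfolding weakly_singular_def by blast
  qed
  show "continuous_on {0..T} (convolution \<Phi> (\<lambda>r. N (segment \<mu> u r) r))" if u: "u \<in> mspace Y"
    using sing_u[OF u] continuous_on_convolution[OF \<Phi> \<alpha> T cont[OF u]] by blast
  show "norm (convolution \<Phi> (\<lambda>r. N (segment \<mu> u r) r) t - convolution \<Phi> (\<lambda>r. N (segment \<mu> v r) r) t)
      \<le> L * (T powr \<alpha> / \<alpha>) * mdist Y u v"
    if u: "u \<in> mspace Y" and v: "v \<in> mspace Y" and t: "t \<in> {0..T}"
  proof -
    obtain C C' where "weakly_singular \<Phi> \<alpha> T (\<lambda>r. N (segment \<mu> u r) r) C"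
      "weakly_singular \<Phi> \<alpha> T (\<lambda>r. N (segment \<mu> v r) r) C'"
      using sing_u[OF u] sing_u[OF v] by blast
    then have "norm (convolution \<Phi> (\<lambda>r. N (segment \<mu> u r) r) t - convolution \<Phi> (\<lambda>r. N (segment \<mu> v r) r) t)
        \<le> L * mdist Y u v * (T powr \<alpha> / \<alpha>)"
    proof (rule norm_convolution_diff_le[OF \<Phi> \<alpha> T cont[OF u] _ cont[OF v] _ _ _ t])
      fix s r :: real assume s: "s > 0" and r: "r \<in> {0..T}"
      have "norm (\<Phi> s (N (segment \<mu> u r) r) - \<Phi> s (N (segment \<mu> v r) r))
          \<le> L * mdist X (segment \<mu> u r) (segment \<mu> v r) * s powr (\<alpha> - 1)"
        by (rule Lip[OF seg[OF u r] seg[OF v r] s r])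
      also have "\<dots> \<le> L * mdist Y u v * s powr (\<alpha> - 1)"
        using mdist_segment_le[OF u[unfolded Y_def] v[unfolded Y_def] r]
        unfolding X_def Y_def by (intro mult_right_mono mult_left_mono L) simp_all
      finally show "norm (\<Phi> s (N (segment \<mu> u r) r) - \<Phi> s (N (segment \<mu> v r) r))
          \<le> L * mdist Y u v * s powr (\<alpha> - 1)" .
    qed (simp add: L)
    then show ?thesis by (simp only: mult.commute mult.left_commute)
  qed
qed

text \<open>The noise terms. The driving path enters linearly, so a bound W for \<omega> becomes a factor of the
  Lipschitz constant.\<close>

lemma singular_Lipschitz_blinfun:
  fixes H :: "(real \<Rightarrow> 'h) \<Rightarrow> 'u::real_normed_vector \<Rightarrow>\<^sub>L 'h::real_normed_vector"
  defines "X \<equiv> path_space (-\<mu>) 0 :: (real \<Rightarrow> 'h) metric"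
  assumes cont: "\<And>u. u \<in> mspace (path_space (-\<mu>) T) \<Longrightarrow> continuous_on {0..T} (\<lambda>r. H (segment \<mu> u r))"
    and sing: "\<And>x. x \<in> mspace X \<Longrightarrow> \<exists>C\<ge>0. \<forall>s>0. \<forall>v. norm (\<Phi> s (H x v)) \<le> C * norm v * s powr (\<alpha> - 1)"
    and Lip: "\<And>x y s v. x \<in> mspace X \<Longrightarrow> y \<in> mspace X \<Longrightarrow> s > 0 \<Longrightarrow>
      norm (\<Phi> s (H x v) - \<Phi> s (H y v)) \<le> L * mdist X x y * norm v * s powr (\<alpha> - 1)"
    and L: "L \<ge> 0"
    and \<omega>: "continuous_on {0..T} \<omega>" "\<And>r. r \<in> {0..T} \<Longrightarrow> norm (\<omega> r) \<le> W"
  shows "singular_Lipschitz \<mu> T \<Phi> \<alpha> (\<lambda>x r. H x (\<omega> r)) (L * W)"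
  unfolding singular_Lipschitz_def X_def[symmetric]
proof (intro conjI ballI allI impI)
  show "continuous_on {0..T} (\<lambda>r. H (segment \<mu> u r) (\<omega> r))"
    if "u \<in> mspace (path_space (-\<mu>) T)" for u
    by (rule bounded_bilinear.continuous_on[OF bounded_bilinear_blinfun_apply cont[OF that] \<omega>(1)])
  show "\<exists>C. weakly_singular \<Phi> \<alpha> T (\<lambda>r. H x (\<omega> r)) C" if x: "x \<in> mspace X" for x
  proof -
    obtain C where "C \<ge> 0" and C: "\<forall>s>0. \<forall>v. norm (\<Phi> s (H x v)) \<le> C * norm v * s powr (\<alpha> - 1)"
      using sing[OF x] by blast
    have "norm (\<Phi> s (H x (\<omega> r))) \<le> C * W * s powr (\<alpha> - 1)" if "s > 0" "r \<in> {0..T}" for s r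
    proof -
      have "norm (\<Phi> s (H x (\<omega> r))) \<le> C * norm (\<omega> r) * s powr (\<alpha> - 1)"
        using C that(1) by blast
      also have "\<dots> \<le> C * W * s powr (\<alpha> - 1)"
        by (rule mult_right_mono[OF mult_left_mono[OF \<omega>(2)[OF that(2)] \<open>C \<ge> 0\<close>]]) simp
      finally show ?thesis .
    qed
    then show ?thesis unfolding weakly_singular_def by blast
  qed
  fix x y s r
  assume xy: "x \<in> mspace X" "y \<in> mspace X" and s: "s > (0::real)" and r: "r \<in> {0..T}"
  have "norm (\<Phi> s (H x (\<omega> r)) - \<Phi> s (H y (\<omega> r))) \<le> L * mdist X x y * norm (\<omega> r) * s powr (\<alpha> - 1)"
    by (rule Lip[OF xy s])
  also have "\<dots> \<le> L * mdist X x y * W * s powr (\<alpha> - 1)"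
    using L by (intro mult_right_mono mult_left_mono \<omega>(2)[OF r]) simp_all
  finally show "norm (\<Phi> s (H x (\<omega> r)) - \<Phi> s (H y (\<omega> r))) \<le> L * W * mdist X x y * s powr (\<alpha> - 1)"
    by (simp only: mult.commute mult.left_commute mult.assoc)
qed

end

section \<open>Local mild solutions\<close>

lemma norm_diff_combination_le:
  fixes a b c d e a' b' c' d' e' :: "'h::real_normed_vector"
  shows "norm (a + b + c + d - e - (a' + b' + c' + d' - e'))
    \<le> norm (a - a') + norm (b - b') + norm (c - c') + norm (d - d') + norm (e - e')"
proof -
  have eq: "a + b + c + d - e - (a' + b' + c' + d' - e')
      = (a - a') + (b - b') + (c - c') + (d - d') - (e - e')" by simp
  show ?thesis
    unfolding eq
    using norm_triangle_ineq4[of "(a - a') + (b - b') + (c - c') + (d - d')" "e - e'"]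
      norm_triangle_ineq[of "(a - a') + (b - b') + (c - c')" "d - d'"]
      norm_triangle_ineq[of "(a - a') + (b - b')" "c - c'"]
      norm_triangle_ineq[of "a - a'" "b - b'"]
    by linarith
qed

text \<open>The number W is fixed first, to absorb the noise terms. Then T is taken so small that \<omega>, which is
  continuous with \<omega> 0 = 0, stays below W, and that the term without noise is absorbed as well.\<close>

lemma small_time:
  fixes \<omega> :: "real \<Rightarrow> 'u::real_normed_vector"
  assumes \<omega>: "continuous_on UNIV \<omega>" "\<omega> 0 = 0" and c: "c \<ge> 0" "c' \<ge> 0" and \<epsilon>: "\<epsilon> > 0"
  obtains T W where "T > 0" "T \<le> 1" "W > 0" "\<And>t. t \<in> {0..T} \<Longrightarrow> norm (\<omega> t) \<le> W"
    "c * T + c' * W \<le> \<epsilon>"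
proof -
  define W where "W = \<epsilon> / (2 * (c' + 1))"
  have W: "W > 0" using c \<epsilon> by (simp add: W_def)
  have c'W: "c' * W \<le> \<epsilon> / 2"
  proof -
    have "c' * W \<le> (c' + 1) * W" using W by simp
    also have "\<dots> = \<epsilon> / 2" using c by (simp add: W_def field_simps)
    finally show ?thesis .
  qed
  have "isCont \<omega> 0" using \<omega>(1) by (simp add: continuous_on_eq_continuous_at)
  then obtain \<delta> where "\<delta> > 0" and \<delta>: "\<And>t. dist t 0 < \<delta> \<Longrightarrow> dist (\<omega> t) (\<omega> 0) < W"
    using W unfolding continuous_at_eps_delta by blast
  define T where "T = min 1 (min (\<delta> / 2) (\<epsilon> / (2 * (c + 1))))"
  have "T > 0" using \<open>\<delta> > 0\<close> c \<epsilon> by (simp add: T_def)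
  moreover have "T \<le> 1" "T \<le> \<delta> / 2" "T \<le> \<epsilon> / (2 * (c + 1))"
    unfolding T_def by linarith+
  ultimately have T: "T > 0" "T \<le> 1" "T \<le> \<delta> / 2" "T \<le> \<epsilon> / (2 * (c + 1))" .
  have cT: "c * T \<le> \<epsilon> / 2"
  proof -
    have "c * T \<le> (c + 1) * (\<epsilon> / (2 * (c + 1)))"
      using c T by (intro mult_mono) simp_all
    also have "\<dots> = \<epsilon> / 2" using c by (simp add: field_simps)
    finally show ?thesis .
  qed
  have "norm (\<omega> t) \<le> W" if "t \<in> {0..T}" for t
    using \<delta>[of t] that \<open>\<delta> > 0\<close> \<omega>(2) T(3) by (simp add: dist_norm)
  moreover have "c * T + c' * W \<le> \<epsilon>" using cT c'W by simp
  ultimately show ?thesis using that T(1,2) W by blast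
qed

theorem theorem2p3:
  fixes A :: "'h::{real_inner,banach,second_countable_topology} \<Rightarrow> 'h"
    and DA :: "'h set"
    and S :: "real \<Rightarrow> 'h \<Rightarrow>\<^sub>L 'h"
    and F :: "(real \<Rightarrow> 'h) \<Rightarrow> 'h"
    and G K :: "(real \<Rightarrow> 'h) \<Rightarrow> 'u::{real_inner,banach,second_countable_topology} \<Rightarrow>\<^sub>L 'h"
    and \<mu> \<beta> \<nu> lam :: real
  assumes \<mu>: "\<mu> > 0"
    and \<beta>: "0 < \<beta>" "\<beta> < 1/2"
    and selfadj: "self_adjoint_op DA (\<lambda>x. - A x)"
    and pos: "strictly_positive_op DA (\<lambda>x. - A x)"
    and cpt: "has_compact_inverse DA (\<lambda>x. - A x)"
    and semigroup: "C0_semigroup S" "analytic_semigroup S" "is_generator DA A S"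
    and lam: "lam > 0"
    and S_decay: "\<And>t. t > 0 \<Longrightarrow> norm (S t) \<le> exp (- lam * t)"
    and S_smooth: "\<And>t \<gamma> x. t > 0 \<Longrightarrow> 0 \<le> \<gamma> \<Longrightarrow> \<gamma> < 1 \<Longrightarrow>
        S t x \<in> frac_dom DA (\<lambda>x. - A x) \<gamma> \<and>
        norm (frac_power DA (\<lambda>x. - A x) \<gamma> (S t x)) \<le> t powr (- \<gamma>) * exp (- lam * t) * norm x"
    and S_diff: "\<And>t \<theta> \<sigma> x. t > 0 \<Longrightarrow> 0 \<le> \<theta> \<Longrightarrow> \<theta> \<le> \<sigma> \<Longrightarrow> \<sigma> \<le> 1 + \<theta> \<Longrightarrow>
        x \<in> frac_dom DA (\<lambda>x. - A x) \<sigma> \<Longrightarrow>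
        S t x - x \<in> frac_dom DA (\<lambda>x. - A x) \<theta> \<and>
        frac_norm DA (\<lambda>x. - A x) \<theta> (S t x - x)
          \<le> t powr (\<sigma> - \<theta>) * frac_norm DA (\<lambda>x. - A x) \<sigma> x"
    and F_Lip: "Lipschitz_continuous_map (path_space (-\<mu>) 0) euclidean_metric F"
    and \<nu>: "0 < \<nu>" "\<nu> < 1"
    and G_range: "\<And>x. x \<in> mspace (path_space (-\<mu>) 0) \<Longrightarrow> G x \<in> frac_blinfuns DA (\<lambda>x. - A x) \<nu>"
    and G_Lip: "\<exists>L. \<forall>x\<in>mspace (path_space (-\<mu>) 0). \<forall>y\<in>mspace (path_space (-\<mu>) 0).
        frac_blinfun_norm DA (\<lambda>x. - A x) \<nu> (G x - G y) \<le> L * mdist (path_space (-\<mu>) 0) x y"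
    and K_Lip: "Lipschitz_continuous_map (path_space (-\<mu>) 0) euclidean_metric K"
    and G_C1: "\<And>T u. T > 0 \<Longrightarrow> u \<in> mspace (path_space (-\<mu>) T) \<Longrightarrow>
        continuous_on {0..T} (\<lambda>t. K (segment \<mu> u t)) \<and>
        (\<forall>t\<in>{0..T}. ((\<lambda>t. G (segment \<mu> u t)) has_vector_derivative K (segment \<mu> u t))
           (at t within {0..T}))"
  shows "\<forall>\<omega>\<in>holder_paths \<beta>. \<exists>T>0.
           (\<forall>\<xi>\<in>mspace (path_space (-\<mu>) 0). \<exists>!u. mild_solution A S F G K \<mu> \<omega> T \<xi> u) \<and>
           continuous_map (mtopology_of (path_space (-\<mu>) 0)) (mtopology_of (path_space (-\<mu>) T))
             (\<lambda>\<xi>. THE u. mild_solution A S F G K \<mu> \<omega> T \<xi> u)"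
proof (rule ballI)
  fix \<omega> :: "real \<Rightarrow> 'u" assume "\<omega> \<in> holder_paths \<beta>"
  then have \<omega>: "continuous_on UNIV \<omega>" "\<omega> 0 = 0"
    unfolding holder_paths_def by blast+
  let ?B = "\<lambda>x. - A x"
  let ?X = "path_space (-\<mu>) 0 :: (real \<Rightarrow> 'h) metric"
  let ?S = "\<lambda>t x. blinfun_apply (S t) x" and ?AS = "\<lambda>t x. A (blinfun_apply (S t) x)"

  \<comment> \<open>Already the zeroth power of \<open>S 1 0\<close> is given by a series over some eigenbasis.\<close>
  obtain E where E: "eigenbasis DA ?B E"
    using S_smooth[of 1 0 0] unfolding frac_dom_def has_frac_power_def by auto
  interpret diagonal_semigroup A DA E S lam
    by unfold_locales (fact selfadj E semigroup lam S_decay)+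

  obtain LF where LF: "LF > 0" and F_le: "\<And>x y. x \<in> mspace ?X \<Longrightarrow> y \<in> mspace ?X \<Longrightarrow>
      dist (F x) (F y) \<le> LF * mdist ?X x y"
    using F_Lip unfolding Lipschitz_continuous_map_pos mdist_euclidean_metric by blast
  obtain LK where LK: "LK > 0" and K_le: "\<And>x y. x \<in> mspace ?X \<Longrightarrow> y \<in> mspace ?X \<Longrightarrow>
      dist (K x) (K y) \<le> LK * mdist ?X x y"
    using K_Lip unfolding Lipschitz_continuous_map_pos mdist_euclidean_metric by blast
  obtain L0 where L0: "\<And>x y. x \<in> mspace ?X \<Longrightarrow> y \<in> mspace ?X \<Longrightarrow>
      frac_blinfun_norm DA ?B \<nu> (G x - G y) \<le> L0 * mdist ?X x y"
    using G_Lip by blast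
  define LG where "LG = \<bar>L0\<bar>"
  have LG: "LG \<ge> 0" by (simp add: LG_def)
  have G_le: "frac_blinfun_norm DA ?B \<nu> (G x - G y) \<le> LG * mdist ?X x y"
    if "x \<in> mspace ?X" "y \<in> mspace ?X" for x y
  proof -
    have "L0 * mdist ?X x y \<le> LG * mdist ?X x y"
      unfolding LG_def by (rule mult_right_mono) simp_all
    with L0[OF that] show ?thesis by simp
  qed
  have G_diff: "G x - G y \<in> frac_blinfuns DA ?B \<nu>" if "x \<in> mspace ?X" "y \<in> mspace ?X" for x y
    by (rule frac_blinfun_diff[OF selfadj E G_range[OF that(1)] G_range[OF that(2)]])
  \<comment> \<open>The Lipschitz constant of G in L(U; H), by the embedding of the fractional domain.\<close>
  define cG where "cG = lam powr (- \<nu>) * LG"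
  have cG: "cG \<ge> 0" using LG by (simp add: cG_def)
  have G_norm_le: "dist (G x) (G y) \<le> cG * mdist ?X x y"
    if xy: "x \<in> mspace ?X" "y \<in> mspace ?X" for x y
  proof -
    have "norm (G x - G y) \<le> lam powr (- \<nu>) * frac_blinfun_norm DA ?B \<nu> (G x - G y)"
      using \<nu> by (intro norm_blinfun_le_frac G_diff xy) simp
    also have "\<dots> \<le> lam powr (- \<nu>) * (LG * mdist ?X x y)"
      by (rule mult_left_mono[OF G_le[OF xy]]) simp
    finally show ?thesis by (simp only: dist_norm cG_def mult.assoc)
  qed

  \<comment> \<open>The four constants are those of the terms with F, with A S G, with G alone and with K; the powers of T
    are estimated by 1.\<close>
  obtain T W where T: "T > 0" "T \<le> 1" and W: "W > 0"
    and \<omega>_le: "\<And>t. t \<in> {0..T} \<Longrightarrow> norm (\<omega> t) \<le> W"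
    and small: "LF * T + (LG / \<nu> + cG + LK) * W \<le> 1 / 2"
  proof (rule small_time[OF \<omega>, of LF "LG / \<nu> + cG + LK" "1 / 2"])
    show "LF \<ge> 0" "LG / \<nu> + cG + LK \<ge> 0" using LF LG cG LK \<nu> by simp_all
  qed simp_all
  let ?Y = "path_space (-\<mu>) T :: (real \<Rightarrow> 'h) metric"
  have \<mu>0: "\<mu> \<ge> 0" and T0: "T \<ge> 0" using \<mu> T by simp_all
  have \<omega>_cont: "continuous_on {0..T} \<omega>" using \<omega>(1) by (rule continuous_on_subset) simp
  have seg: "segment \<mu> u t \<in> mspace ?X" if "u \<in> mspace ?Y" "t \<in> {0..T}" for u t
    using segment_in_path_space[OF \<mu>0 T0] that by blast
  note cont_seg = continuous_on_Lipschitz_segment[OF \<mu>0 T0]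

  have "singular_Lipschitz \<mu> T ?S 1 (\<lambda>x r. F x) LF"
    unfolding singular_Lipschitz_def
  proof (intro conjI ballI allI impI)
    show "continuous_on {0..T} (\<lambda>r. F (segment \<mu> u r))" if "u \<in> mspace ?Y" for u
      by (rule cont_seg[OF F_le less_imp_le[OF LF] that])
    show "\<exists>C. weakly_singular ?S 1 T (\<lambda>r. F x) C" for x
      using norm_S_le[of _ "F x"] unfolding weakly_singular_def by (intro exI[of _ "norm (F x)"]) simp
    show "norm (S s (F x) - S s (F y)) \<le> LF * mdist ?X x y * s powr (1 - 1)"
      if "x \<in> mspace ?X" "y \<in> mspace ?X" "s > 0" for x y s
      using norm_S_le[OF \<open>s > 0\<close>, of "F x - F y"] F_le[of x y] that
      by (simp add: blinfun.diff_right dist_norm)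
  qed
  note F_conv = delay_convolution[OF \<mu>0 T0 convolution_kernel_S zero_less_one less_imp_le[OF LF] this]

  have LKW: "LK * W \<ge> 0" using LK W by simp
  have K_term: "norm (S s (L v)) \<le> norm L * norm v * s powr (1 - 1)"
    if "s > 0" for L :: "'u \<Rightarrow>\<^sub>L 'h" and s v
    using order_trans[OF norm_S_le[OF that] norm_blinfun[of L v]] that by simp
  have "singular_Lipschitz \<mu> T ?S 1 (\<lambda>x r. K x (\<omega> r)) (LK * W)"
  proof (rule singular_Lipschitz_blinfun[OF \<mu>0 T0 _ _ _ less_imp_le[OF LK] \<omega>_cont \<omega>_le])
    show "continuous_on {0..T} (\<lambda>r. K (segment \<mu> u r))" if "u \<in> mspace ?Y" for u
      by (rule cont_seg[OF K_le less_imp_le[OF LK] that])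
    show "\<exists>C\<ge>0. \<forall>s>0. \<forall>v. norm (S s (K x v)) \<le> C * norm v * s powr (1 - 1)" for x
      by (intro exI[of _ "norm (K x)"] conjI allI impI K_term) simp
    fix x y :: "real \<Rightarrow> 'h" and s v
    assume xy: "x \<in> mspace ?X" "y \<in> mspace ?X" and s: "s > (0::real)"
    have "norm (S s (K x v) - S s (K y v)) \<le> norm (K x - K y) * norm v * s powr (1 - 1)"
      using K_term[OF s, of "K x - K y" v] by (simp only: blinfun.diff_right blinfun.diff_left)
    also have "\<dots> \<le> LK * mdist ?X x y * norm v * s powr (1 - 1)"
      using K_le[OF xy] by (intro mult_right_mono) (simp_all add: dist_norm)
    finally show "norm (S s (K x v) - S s (K y v)) \<le> LK * mdist ?X x y * norm v * s powr (1 - 1)" .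
  qed
  note K_conv = delay_convolution[OF \<mu>0 T0 convolution_kernel_S zero_less_one LKW this]

  have LGW: "LG * W \<ge> 0" using LG W by simp
  have G_cont: "continuous_on {0..T} (\<lambda>r. G (segment \<mu> u r))" if "u \<in> mspace ?Y" for u
    by (rule cont_seg[OF G_norm_le cG that])
  have "singular_Lipschitz \<mu> T ?AS \<nu> (\<lambda>x r. G x (\<omega> r)) (LG * W)"
  proof (rule singular_Lipschitz_blinfun[OF \<mu>0 T0 G_cont _ _ LG \<omega>_cont \<omega>_le])
    show "\<exists>C\<ge>0. \<forall>s>0. \<forall>v. norm (A (S s (G x v))) \<le> C * norm v * s powr (\<nu> - 1)"
      if "x \<in> mspace ?X" for x
      using \<nu> norm_A_S_blinfun_le[OF G_range[OF that]] frac_blinfun_norm_nonneg[OF G_range[OF that]]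
      by (intro exI[of _ "frac_blinfun_norm DA ?B \<nu> (G x)"]) simp
    fix x y :: "real \<Rightarrow> 'h" and s v
    assume xy: "x \<in> mspace ?X" "y \<in> mspace ?X" and s: "s > (0::real)"
    have "norm (A (S s (G x v)) - A (S s (G y v))) = norm (A (S s ((G x - G y) v)))"
      using linear_diff[OF linear_A_S[OF s], of "G x v" "G y v"] by (simp add: blinfun.diff_left)
    also have "\<dots> \<le> frac_blinfun_norm DA ?B \<nu> (G x - G y) * norm v * s powr (\<nu> - 1)"
      using \<nu> by (intro norm_A_S_blinfun_le G_diff xy s) simp_all
    also have "\<dots> \<le> LG * mdist ?X x y * norm v * s powr (\<nu> - 1)"
      by (intro mult_right_mono G_le xy) simp_all
    finally show "norm (A (S s (G x v)) - A (S s (G y v))) \<le> LG * mdist ?X x y * norm v * s powr (\<nu> - 1)" .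
  qed
  note G_conv = delay_convolution[OF \<mu>0 T0 convolution_kernel_A_S \<nu>(1) LGW this]

  define V where "V \<xi> u t = S t (\<xi> 0) + convolution ?S (\<lambda>r. F (segment \<mu> u r)) t
      + convolution ?AS (\<lambda>r. G (segment \<mu> u r) (\<omega> r)) t + G (segment \<mu> u t) (\<omega> t)
      - convolution ?S (\<lambda>r. K (segment \<mu> u r) (\<omega> r)) t"
    for \<xi> u :: "real \<Rightarrow> 'h" and t
  have V_cont: "continuous_on {0..T} (V \<xi> u)" if "u \<in> mspace ?Y" for \<xi> u
    unfolding V_def using that
    by (intro continuous_on_add continuous_on_diff F_conv(1) G_conv(1) K_conv(1)
        bounded_bilinear.continuous_on[OF bounded_bilinear_blinfun_apply G_cont \<omega>_cont]
        continuous_on_subset[OF continuous_on_S]) auto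
  \<comment> \<open>At time 0 the term \<open>G (segment \<mu> u 0) (\<omega> 0)\<close> vanishes even if u does not extend \<xi>.\<close>
  have V_init: "V \<xi> u 0 = \<xi> 0" for \<xi> u
    using semigroup(1) \<omega>(2) by (simp add: V_def C0_semigroup_def)
  have V_contr: "dist (V \<xi> u t) (V \<eta> v t) \<le> mdist ?X \<xi> \<eta> + mdist ?Y u v / 2"
    if \<xi>: "\<xi> \<in> mspace ?X" "\<eta> \<in> mspace ?X" and uv: "u \<in> mspace ?Y" "v \<in> mspace ?Y" and t: "t \<in> {0..T}"
    for \<xi> \<eta> u v t
  proof -
    let ?d = "mdist ?Y u v"
    have n1: "norm (S t (\<xi> 0) - S t (\<eta> 0)) \<le> mdist ?X \<xi> \<eta>"
    proof -
      have "norm (S t (\<xi> 0) - S t (\<eta> 0)) \<le> norm (\<xi> 0 - \<eta> 0)"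
      proof (cases "t = 0")
        case True
        then show ?thesis using semigroup(1) by (simp add: C0_semigroup_def)
      next
        case False
        then show ?thesis
          using norm_S_le[of t "\<xi> 0 - \<eta> 0"] t by (simp add: blinfun.diff_right)
      qed
      also have "\<dots> \<le> mdist ?X \<xi> \<eta>"
        using dist_le_mdist_path_space[OF \<xi>, of 0] \<mu> by (simp add: dist_norm)
      finally show ?thesis .
    qed
    have n2: "norm (convolution ?S (\<lambda>r. F (segment \<mu> u r)) t - convolution ?S (\<lambda>r. F (segment \<mu> v r)) t)
        \<le> LF * T * ?d"
      using F_conv(2)[OF uv t] T by simp
    have n3: "norm (convolution ?AS (\<lambda>r. G (segment \<mu> u r) (\<omega> r)) t
          - convolution ?AS (\<lambda>r. G (segment \<mu> v r) (\<omega> r)) t) \<le> LG / \<nu> * W * ?d"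
    proof -
      have "LG * W * (T powr \<nu> / \<nu>) \<le> LG * W * (1 / \<nu>)"
        using T \<nu> LGW by (intro mult_left_mono divide_right_mono powr_le1) simp_all
      also have "\<dots> = LG / \<nu> * W" by simp
      finally have "LG * W * (T powr \<nu> / \<nu>) * ?d \<le> LG / \<nu> * W * ?d"
        by (rule mult_right_mono) simp
      with G_conv(2)[OF uv t] show ?thesis by (rule order_trans)
    qed
    have n4: "norm (G (segment \<mu> u t) (\<omega> t) - G (segment \<mu> v t) (\<omega> t)) \<le> cG * W * ?d"
    proof -
      have "norm ((G (segment \<mu> u t) - G (segment \<mu> v t)) (\<omega> t))
          \<le> norm (G (segment \<mu> u t) - G (segment \<mu> v t)) * norm (\<omega> t)"
        by (rule norm_blinfun)
      also have "\<dots> \<le> (cG * mdist ?X (segment \<mu> u t) (segment \<mu> v t)) * W"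
        using G_norm_le[OF seg[OF uv(1) t] seg[OF uv(2) t]] \<omega>_le[OF t] cG
        by (intro mult_mono) (simp_all add: dist_norm)
      also have "\<dots> \<le> (cG * ?d) * W"
        using W by (intro mult_right_mono mult_left_mono[OF mdist_segment_le[OF \<mu>0 T0 uv t] cG]) simp
      finally show ?thesis by (simp add: blinfun.diff_left mult_ac)
    qed
    have n5: "norm (convolution ?S (\<lambda>r. K (segment \<mu> u r) (\<omega> r)) t
          - convolution ?S (\<lambda>r. K (segment \<mu> v r) (\<omega> r)) t) \<le> LK * W * ?d"
    proof -
      have "LK * W * (T powr 1 / 1) \<le> LK * W * 1"
        using T LKW by (intro mult_left_mono) simp_all
      then have "LK * W * (T powr 1 / 1) * ?d \<le> LK * W * 1 * ?d"
        by (rule mult_right_mono) simp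
      with K_conv(2)[OF uv t] show ?thesis by simp
    qed
    have "LF * T * ?d + LG / \<nu> * W * ?d + cG * W * ?d + LK * W * ?d
        = (LF * T + (LG / \<nu> + cG + LK) * W) * ?d" by (simp only: distrib_right)
    also have "\<dots> \<le> 1 / 2 * ?d"
      by (rule mult_right_mono[OF small]) simp
    finally show ?thesis
      using n1 n2 n3 n4 n5 unfolding dist_norm V_def
      by (intro order_trans[OF norm_diff_combination_le]) linarith
  qed
  have sol: "mild_solution A S F G K \<mu> \<omega> T \<xi> u \<longleftrightarrow>
      u \<in> mspace ?Y \<and> (\<forall>t\<in>{-\<mu>..0}. u t = \<xi> t) \<and> (\<forall>t\<in>{0..T}. u t = V \<xi> u t)" for \<xi> u
    unfolding mild_solution_def V_def convolution_def ..
  have ex1: "\<forall>\<xi>\<in>mspace ?X. \<exists>!u. mild_solution A S F G K \<mu> \<omega> T \<xi> u"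
    by (rule delay_equation_wellposed(1)[OF \<mu>0 T0, where V = V];
        (rule V_cont V_init V_contr sol; assumption))
  have cont: "continuous_map (mtopology_of ?X) (mtopology_of ?Y)
      (\<lambda>\<xi>. THE u. mild_solution A S F G K \<mu> \<omega> T \<xi> u)"
    by (rule delay_equation_wellposed(2)[OF \<mu>0 T0, where V = V];
        (rule V_cont V_init V_contr sol; assumption))
  show "\<exists>T>0. (\<forall>\<xi>\<in>mspace ?X. \<exists>!u. mild_solution A S F G K \<mu> \<omega> T \<xi> u) \<and>
      continuous_map (mtopology_of ?X) (mtopology_of (path_space (-\<mu>) T))
        (\<lambda>\<xi>. THE u. mild_solution A S F G K \<mu> \<omega> T \<xi> u)"
    by (intro exI[of _ T] conjI T(1) ex1 cont)
qed

end
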